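(* Let $\Omega=(0,1)^2\subset\mathbb{R}^2$, let $E\subset\partial\Omega$ be open, let $N_{max}\in\mathbb{N}$, let $\mathcal{M}$ be the corresponding visible set, and let $K\Subset\mathcal{M}$. Then the unattenuated broken ray transform $I_{0,E}$ is injective on $L^2(K)$.
   Context: $\Omega=(0,1)^2$ is the open unit square, $E\subset\partial\Omega$ is (relatively) open, and $\nu$ is the outward unit normal on $\partial\Omega$. Put $\Gamma_{\pm}=\{(x,\theta)\in\partial\Omega\times\mathbb{S}^1:\pm\nu(x)\cdot\theta>0\}$ and $\Gamma_\pm(E)=\{(x,\theta)\in\Gamma_\pm: x\in E\}$ (at a corner point $x$, $\Gamma_-$ is understood to consist of directions pointing into $\Omega$). Billiard map. $T:\Gamma_-\to\Gamma_-$ sends $(x,\theta)$ to $(x',\theta')$, where $x'$ is the next point of $\partial\Omega$ on the ray $x+t\theta$, $t>0$, and $\theta'=\theta-2(\nu(x')\cdot\theta)\nu(x')$; if $x'$ is a corner, the ray returns in the opposite direction, $\theta'=-\theta$ (the limit of the nearby trajectories), and this counts as one reflection. $\pi_1,\pi_2$ are the projections of $\Gamma_-$ to $\partial\Omega$ and $\mathbb{S}^1$. Regular broken rays. For $(x,\theta)\in\Gamma_-(E)$, $\gamma_{x,\theta}$ is the unit speed broken ray starting at $x$ in direction $\theta$, reflecting at points $x'\in\partial\Omega\setminus E$ by the law $\theta'=\theta-2(\nu(x')\cdot\theta)\nu(x')$ (and $\theta'=-\theta$ if $x'$ is a corner), and ending when it hits $E$ again. It is regular if it consists of finitely many straight segments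 before hitting $E$ again and does not intersect $\partial E$ (the boundary of $E$ relative to $\partial\Omega$). $N(x,\theta)=N(\gamma_{x,\theta})$ is the number of its reflections before it hits $E$ again. Transform. Extending $f$ by zero outside $\Omega$, for regular $\gamma_{x,\theta}$, $$I_{0,E}f(x,\theta)=\sum_{j=0}^{N(x,\theta)}\int_0^\infty f\big(\pi_1\circ T^j(x,\theta)+t\,\pi_2\circ T^j(x,\theta)\big)\,dt .$$ Visible set. $\mathcal{M}$ is the set of $x\in\Omega$ such that for every $\xi\in\mathbb{S}^1$ there is a regular broken ray $\gamma$ with $N(\gamma)\le N_{max}$ and $(x,\xi)\in N^*\gamma$, where $N^*\gamma$ is the conormal bundle of $\gamma$, i.e. $\gamma$ passes through $x$ with a tangent direction orthogonal to $\xi$. $L^2(K)$ denotes the functions in $L^2(\Omega)$ supported in $K$, and $K\Subset\mathcal{M}$ means $K$ is compactly contained in $\mathcal{M}$. Injectivity on $L^2(K)$ means: if $f\in L^2(K)$ and $I_{0,E}f(x,\theta)=0$ for (almost) all $(x,\theta)\in\Gamma_-(E)$ with $\gamma_{x,\theta}$ regular, then $f=0$. *)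

theory Defs
  imports "HOL-Analysis.Analysis"
begin

type_synonym plane = "real \<times> real"

definition Omega :: "plane set" where
  "Omega = {0<..<1} \<times> {0<..<1}"

abbreviation bdry :: "plane set" where
  "bdry \<equiv> frontier Omega"

definition corners :: "plane set" where
  "corners = {0, 1} \<times> {0, 1}"

text \<open>Outward unit normal on the boundary of the square. It is only meaningful at boundary
  points that are not corners, and is only used there.\<close>

definition nu :: "plane \<Rightarrow> plane" where
  "nu x = (if fst x = 0 then (-1, 0) else if fst x = 1 then (1, 0)
           else if snd x = 0 then (0, -1) else (0, 1))"

definition Gamma_minus :: "(plane \<times> plane) set" where
  "Gamma_minus = {(x, \<theta>). x \<in> bdry \<and> norm \<theta> = 1 \<and>
     (if x \<in> corners then \<exists>\<epsilon>>0. \<forall>t\<in>{0<..<\<epsilon>}. x + t *\<^sub>R \<theta> \<in> Omega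
      else nu x \<bullet> \<theta> < 0)}"

definition Gamma_minus_on :: "plane set \<Rightarrow> (plane \<times> plane) set" where
  "Gamma_minus_on E = {z \<in> Gamma_minus. fst z \<in> E}"

text \<open>For \<open>(x, \<theta>)\<close> in \<^const>\<open>Gamma_minus\<close> the ray meets the boundary at exactly one
  positive time, so the least such time exists.\<close>

definition exit_time :: "plane \<Rightarrow> plane \<Rightarrow> real" where
  "exit_time x \<theta> = (LEAST t. 0 < t \<and> x + t *\<^sub>R \<theta> \<in> bdry)"

definition reflect :: "plane \<Rightarrow> plane \<Rightarrow> plane" where
  "reflect x \<theta> = (if x \<in> corners then - \<theta> else \<theta> - (2 * (nu x \<bullet> \<theta>)) *\<^sub>R nu x)"

text \<open>The billiard map; only its values on \<^const>\<open>Gamma_minus\<close> matter.\<close>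

definition billiard :: "plane \<times> plane \<Rightarrow> plane \<times> plane" where
  "billiard = (\<lambda>(x, \<theta>). let x' = x + exit_time x \<theta> *\<^sub>R \<theta> in (x', reflect x' \<theta>))"

definition vertex :: "plane \<times> plane \<Rightarrow> nat \<Rightarrow> plane" where
  "vertex z j = fst ((billiard ^^ j) z)"

definition direction :: "plane \<times> plane \<Rightarrow> nat \<Rightarrow> plane" where
  "direction z j = snd ((billiard ^^ j) z)"

text \<open>The broken ray issued from \<open>z\<close> runs through the boundary points \<open>vertex z 0\<close>,
  \<open>vertex z 1\<close> and so on, and stops at the first \<open>vertex z (Suc n)\<close> lying in \<open>E\<close>; it has then
  been reflected \<open>n\<close> times. It has finitely many segments iff such an \<open>n\<close> exists.\<close>

definition returns :: "plane set \<Rightarrow> plane \<times> plane \<Rightarrow> bool" where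
  "returns E z \<longleftrightarrow> (\<exists>n. vertex z (Suc n) \<in> E)"

definition num_refl :: "plane set \<Rightarrow> plane \<times> plane \<Rightarrow> nat" where
  "num_refl E z = (LEAST n. vertex z (Suc n) \<in> E)"

definition broken_ray :: "plane set \<Rightarrow> plane \<times> plane \<Rightarrow> plane set" where
  "broken_ray E z = (\<Union>j\<le>num_refl E z. closed_segment (vertex z j) (vertex z (Suc j)))"

definition regular :: "plane set \<Rightarrow> plane \<times> plane \<Rightarrow> bool" where
  "regular E z \<longleftrightarrow> z \<in> Gamma_minus_on E \<and> returns E z \<and>
     broken_ray E z \<inter> (top_of_set bdry frontier_of E) = {}"

definition conormal :: "plane set \<Rightarrow> plane \<times> plane \<Rightarrow> (plane \<times> plane) set" where
  "conormal E z = {(x, \<xi>). \<exists>j\<le>num_refl E z.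
     x \<in> open_segment (vertex z j) (vertex z (Suc j)) \<and> \<xi> \<bullet> direction z j = 0}"

definition visible :: "plane set \<Rightarrow> nat \<Rightarrow> plane set" where
  "visible E Nmax = {x \<in> Omega. \<forall>\<xi>\<in>sphere 0 1.
     \<exists>z. regular E z \<and> num_refl E z \<le> Nmax \<and> (x, \<xi>) \<in> conormal E z}"

definition compactly_contained :: "plane set \<Rightarrow> plane set \<Rightarrow> bool" where
  "compactly_contained K M \<longleftrightarrow> compact (closure K) \<and> closure K \<subseteq> M"

definition L2_supported :: "plane set \<Rightarrow> (plane \<Rightarrow> complex) set" where
  "L2_supported K = {f. f \<in> borel_measurable (lebesgue_on Omega) \<and>
     integrable (lebesgue_on Omega) (\<lambda>x. (norm (f x))\<^sup>2) \<and>
     (AE x in lebesgue_on Omega. x \<notin> K \<longrightarrow> f x = 0)}"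

definition zero_extend :: "(plane \<Rightarrow> complex) \<Rightarrow> plane \<Rightarrow> complex" where
  "zero_extend f x = (if x \<in> Omega then f x else 0)"

text \<open>The integrals are taken with respect to Lebesgue rather than Borel measure, since the
  restriction of a Lebesgue measurable \<open>f\<close> to almost every line is only Lebesgue measurable.
  On the exceptional null set of rays where a line integral does not exist it is \<open>0\<close> by
  convention.\<close>

definition broken_ray_transform ::
    "plane set \<Rightarrow> (plane \<Rightarrow> complex) \<Rightarrow> plane \<times> plane \<Rightarrow> complex" where
  "broken_ray_transform E f z = (\<Sum>j\<le>num_refl E z.
     (LINT t:{0<..}|lebesgue. zero_extend f (vertex z j + t *\<^sub>R direction z j)))"

text \<open>Arc length on the boundary of the square (traversed counterclockwise from the origin) and
  on the unit circle.\<close>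

definition perimeter :: "real \<Rightarrow> plane" where
  "perimeter s = (if s < 1 then (s, 0) else if s < 2 then (1, s - 1)
                  else if s < 3 then (3 - s, 1) else (0, 4 - s))"

definition bdry_measure :: "plane measure" where
  "bdry_measure = distr (restrict_space lborel {0..<4}) borel perimeter"

definition circle_measure :: "plane measure" where
  "circle_measure = distr (restrict_space lborel {0..<2 * pi}) borel (\<lambda>\<alpha>. (cos \<alpha>, sin \<alpha>))"

text \<open>Injectivity of the (linear) transform as triviality of its kernel, for \<open>f\<close> considered up
  to equality almost everywhere and data known on almost all regular broken rays.\<close>

definition transform_injective_on :: "plane set \<Rightarrow> plane set \<Rightarrow> bool" where
  "transform_injective_on E K \<longleftrightarrow> (\<forall>f\<in>L2_supported K.
     (AE z in bdry_measure \<Otimes>\<^sub>M circle_measure.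
        z \<in> Gamma_minus_on E \<and> regular E z \<longrightarrow> broken_ray_transform E f z = 0) \<longrightarrow>
     (AE x in lebesgue_on Omega. f x = 0))"

end

theory Submission
  imports Defs
begin

text \<open>Only nearly horizontal rays are needed. If \<open>f\<close> were not zero, let \<open>q\<close> be the largest height
  reached by its essential support. Some \<open>(p, q)\<close> lies in the closure of \<open>K\<close>, so the horizontal broken
  ray at height \<open>q\<close> is regular; it starts on a vertical side and has at most one reflection, and the
  same holds for all rays of small slope starting nearby. Unfolding the reflection, the transform
  becomes \<open>\<integral> g (x, b + a x) dx\<close>, where \<open>g\<close> consists of \<open>f\<close> on the unit square and, if there is a
  reflection, its mirror image on the adjacent square. These integrals vanish for small \<open>a > 0\<close> and
  all \<open>b > c\<close> with some \<open>c < q\<close>: either by the hypothesis, or, if \<open>b > q\<close>, because the line passes above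
  the support. Integrating against \<open>max 0 (b - c) ^ n\<close> and differentiating \<open>j\<close> times in \<open>a\<close> shows that
  \<open>g\<close> is orthogonal to all \<open>x ^ j * max 0 (y - a x - c) ^ n\<close> with \<open>n \<ge> 1\<close>, so by Stone--Weierstrass
  \<open>g\<close> vanishes above the line \<open>y = a x + c\<close>, and hence above a height smaller than \<open>q\<close>.\<close>

section \<open>Shears and reflections of the plane\<close>

text \<open>With \<open>\<tau> = 1\<close> or \<open>\<tau> = -1\<close> this single family covers
  both the shear along lines of slope \<open>a\<close> and, for \<open>a = 0\<close>, the
  reflections used to unfold a broken ray.\<close>

definition skew :: "real \<Rightarrow> real \<Rightarrow> real \<Rightarrow> plane \<Rightarrow> plane" where
  "skew p \<tau> a = (\<lambda>(x, y). (p + \<tau> * x, y + a * x))"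

lemma borel_measurable_skew [measurable]: "skew p \<tau> a \<in> borel \<rightarrow>\<^sub>M borel"
  unfolding skew_def by (simp add: borel_prod[symmetric])

text \<open>By Tonelli: on each vertical slice the map is a translation in \<open>y\<close>, and
  what remains is an isometry of the \<open>x\<close> axis.\<close>

lemma distr_skew:
  assumes "\<bar>\<tau>\<bar> = 1"
  shows "distr lborel lborel (skew p \<tau> a) = lborel"
proof (rule measure_eqI)
  fix A assume "A \<in> sets (distr lborel lborel (skew p \<tau> a))"
  then have A': "A \<in> sets borel" by simp
  then have A [measurable]: "A \<in> sets (borel \<Otimes>\<^sub>M borel)"
    unfolding borel_prod .
  have slice: "(\<integral>\<^sup>+y. indicator A (u, y + v) \<partial>lborel) = (\<integral>\<^sup>+y. indicator A (u, y) \<partial>lborel)" for u v :: real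
    by (subst nn_integral_real_affine[of "\<lambda>y. indicator A (u, y)" 1 v]) (auto simp: add.commute)
  have "emeasure (distr lborel lborel (skew p \<tau> a)) A = (\<integral>\<^sup>+z. indicator A (skew p \<tau> a z) \<partial>lborel)"
    using A' by (subst nn_integral_indicator[symmetric], simp, subst nn_integral_distr) auto
  also have "\<dots> = (\<integral>\<^sup>+x. \<integral>\<^sup>+y. indicator A (skew p \<tau> a (x, y)) \<partial>lborel \<partial>lborel)"
    unfolding lborel_prod[symmetric]
    by (rule lborel.nn_integral_fst[symmetric]) (simp add: skew_def)
  also have "\<dots> = (\<integral>\<^sup>+x. \<integral>\<^sup>+y. indicator A (p + \<tau> * x, y) \<partial>lborel \<partial>lborel)"
    unfolding skew_def by (simp add: slice)
  also have "\<dots> = (\<integral>\<^sup>+x. \<integral>\<^sup>+y. indicator A (x, y) \<partial>lborel \<partial>lborel)"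
    using assms by (subst nn_integral_real_affine[of "\<lambda>x. \<integral>\<^sup>+y. indicator A (x, y) \<partial>lborel" \<tau> p]) auto
  also have "\<dots> = (\<integral>\<^sup>+z. indicator A z \<partial>lborel)"
    unfolding lborel_prod[symmetric] by (rule lborel.nn_integral_fst) simp
  finally show "emeasure (distr lborel lborel (skew p \<tau> a)) A = emeasure lborel A"
    using A' by simp
qed auto

lemma AE_skew:
  assumes "\<bar>\<tau>\<bar> = 1" "AE z in lborel. P z"
  shows "AE z in lborel. P (skew p \<tau> a z)"
proof (rule AE_distrD[of "skew p \<tau> a" lborel lborel])
  show "AE z in distr lborel lborel (skew p \<tau> a). P z"
    unfolding distr_skew[OF assms(1)] by (rule assms(2))
qed simp

lemma
  fixes G :: "plane \<Rightarrow> 'b :: {banach, second_countable_topology}"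
  assumes "\<bar>\<tau>\<bar> = 1" and G [measurable]: "integrable lborel G"
  shows integrable_skew: "integrable lborel (\<lambda>z. G (skew p \<tau> a z))"
    and integral_skew: "(LINT z|lborel. G (skew p \<tau> a z)) = integral\<^sup>L lborel G"
proof -
  have [measurable]: "skew p \<tau> a \<in> lborel \<rightarrow>\<^sub>M lborel" by simp
  show "integrable lborel (\<lambda>z. G (skew p \<tau> a z))"
    by (rule integrable_distr[of "skew p \<tau> a" lborel lborel])
      (simp, unfold distr_skew[OF assms(1)], rule G)
  have "integral\<^sup>L (distr lborel lborel (skew p \<tau> a)) G = (LINT z|lborel. G (skew p \<tau> a z))"
    by (rule integral_distr) auto
  then show "(LINT z|lborel. G (skew p \<tau> a z)) = integral\<^sup>L lborel G"
    unfolding distr_skew[OF assms(1)] by simp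
qed

text \<open>Fubini for null sets with the second coordinate outermost: the direction of a ray, or
  the height of a line, is fixed first.\<close>

lemma (in pair_sigma_finite) AE_pair_swap:
  assumes "AE z in M1 \<Otimes>\<^sub>M M2. P z"
  shows "AE y in M2. AE x in M1. P (x, y)"
proof -
  interpret Q: pair_sigma_finite M2 M1 ..
  have "AE z in M2 \<Otimes>\<^sub>M M1. P (case z of (y, x) \<Rightarrow> (x, y))"
  proof (rule AE_distrD[of _ _ "M1 \<Otimes>\<^sub>M M2"])
    show "AE z in distr (M2 \<Otimes>\<^sub>M M1) (M1 \<Otimes>\<^sub>M M2) (\<lambda>(y, x). (x, y)). P z"
      unfolding distr_pair_swap[symmetric] by (rule assms)
  qed simp
  from Q.AE_pair[OF this] show ?thesis by simp
qed

lemma AE_lborel_snd_fst: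
  fixes P :: "plane \<Rightarrow> bool"
  assumes "AE z in lborel. P z"
  shows "AE y in lborel. AE x in lborel. P (x, y)"
  using lborel_pair.AE_pair_swap[of P] assms unfolding lborel_prod .

text \<open>Fubini after a shear: the plane is swept by parallel lines, and \<open>b\<close> is the
  height of a line at parameter \<open>x = 0\<close>.\<close>

lemma integral_skew_iterated:
  fixes G :: "plane \<Rightarrow> 'b :: {banach, second_countable_topology}"
  assumes "\<bar>\<tau>\<bar> = 1" "integrable lborel G"
  shows "AE b in lborel. integrable lborel (\<lambda>x. G (p + \<tau> * x, b + a * x))"
    and "(LINT b|lborel. LINT x|lborel. G (p + \<tau> * x, b + a * x)) = integral\<^sup>L lborel G"
proof -
  let ?H = "\<lambda>x b. G (p + \<tau> * x, b + a * x)"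
  have eq: "case_prod ?H = (\<lambda>z. G (skew p \<tau> a z))" by (auto simp: skew_def)
  have H: "integrable (lborel \<Otimes>\<^sub>M lborel) (case_prod ?H)"
    unfolding lborel_prod eq by (rule integrable_skew[OF assms])
  show "AE b in lborel. integrable lborel (\<lambda>x. G (p + \<tau> * x, b + a * x))"
    using lborel_pair.AE_integrable_snd[OF H] .
  show "(LINT b|lborel. LINT x|lborel. G (p + \<tau> * x, b + a * x)) = integral\<^sup>L lborel G"
    unfolding lborel_pair.integral_snd[OF H] unfolding lborel_prod eq by (rule integral_skew[OF assms])
qed

section \<open>Functions determined by their moments\<close>

lemma integrable_scaleR_compact_support:
  fixes g :: "'a :: euclidean_space \<Rightarrow> 'b :: {banach, second_countable_topology}" and \<phi> :: "'a \<Rightarrow> real"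
  assumes g [measurable]: "integrable lborel g" and \<phi>: "continuous_on UNIV \<phi>"
    and S: "compact S" "\<And>z. z \<notin> S \<Longrightarrow> g z = 0"
  shows "integrable lborel (\<lambda>z. \<phi> z *\<^sub>R g z)"
proof -
  have [measurable]: "\<phi> \<in> borel_measurable borel" by (rule borel_measurable_continuous_onI[OF \<phi>])
  have "compact (\<phi> ` S)" using \<phi> S(1) by (meson compact_continuous_image continuous_on_subset subset_UNIV)
  then obtain B where B: "\<And>z. z \<in> S \<Longrightarrow> \<bar>\<phi> z\<bar> \<le> B"
    by (metis bounded_real compact_imp_bounded imageI)
  show ?thesis
  proof (rule Bochner_Integration.integrable_bound)
    show "integrable lborel (\<lambda>z. B * norm (g z))" using g by simp
    show "AE z in lborel. norm (\<phi> z *\<^sub>R g z) \<le> norm (B * norm (g z))"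
    proof (rule AE_I2)
      fix z show "norm (\<phi> z *\<^sub>R g z) \<le> norm (B * norm (g z))"
        using B[of z] S(2)[of z] by (cases "z \<in> S") (auto intro: mult_right_mono order_trans[OF _ abs_ge_self] simp: abs_mult)
    qed
  qed simp
qed

text \<open>The closed sets form an intersection-stable generator of the Borel sets, so all Borel
  integrals of \<open>w\<close> vanish; those over the sets where \<open>w\<close> is positive or
  negative then force \<open>w = 0\<close>.\<close>

lemma AE_zero_if_integral_closed_zero:
  fixes w :: "'a :: euclidean_space \<Rightarrow> real"
  assumes w [measurable]: "integrable lborel w"
    and closed0: "\<And>C. closed C \<Longrightarrow> (LINT z:C|lborel. w z) = 0"
  shows "AE z in lborel. w z = 0"
proof -
  have int: "set_integrable lborel A w" if "A \<in> sets borel" for A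
    using that w unfolding set_integrable_def by (intro integrable_mult_indicator) auto
  have zero: "(LINT z:A|lborel. w z) = 0" if "A \<in> sets borel" for A
  proof -
    have "Int_stable (Collect (closed :: 'a set \<Rightarrow> bool))"
      by (auto simp: Int_stable_def)
    moreover have "Collect (closed :: 'a set \<Rightarrow> bool) \<subseteq> Pow UNIV" by simp
    moreover have "A \<in> sigma_sets UNIV (Collect closed)"
      using that unfolding borel_eq_closed by simp
    ultimately show ?thesis
    proof (induction rule: sigma_sets_induct_disjoint)
      case (basic A) then show ?case using closed0 by simp
    next
      case empty show ?case by (simp add: set_lebesgue_integral_def)
    next
      case (compl A)
      then have "A \<in> sets borel" unfolding borel_eq_closed by simp
      \<comment> \<open>\<open>UNIV\<close> is closed, so the total integral is 0 and the property
        passes to complements.\<close>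
      then have "(LINT z:UNIV|lborel. w z) = (LINT z:A|lborel. w z) + (LINT z:UNIV - A|lborel. w z)"
        by (subst set_integral_Un[symmetric]) (auto intro!: int)
      then show ?case using closed0[of UNIV] compl by simp
    next
      case (union A)
      then have "A i \<in> sets lborel" for i unfolding sets_lborel borel_eq_closed by auto
      then have "(LINT z:(\<Union>i. A i)|lborel. w z) = (\<Sum>i. LINT z:A i|lborel. w z)"
        using union(1) by (intro lebesgue_integral_countable_add)
          (auto intro!: int simp: disjoint_family_on_def)
      then show ?case using union by simp
    qed
  qed
  have half: "AE z in lborel. \<not> 0 < v z" if v [measurable]: "integrable lborel v"
    and 0: "(LINT z:{z. 0 < v z}|lborel. v z) = 0" for v :: "'a \<Rightarrow> real"
  proof -
    have "AE z in lborel. indicator {z. 0 < v z} z *\<^sub>R v z = 0"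
    proof (subst integral_nonneg_eq_0_iff_AE[symmetric])
      show "integrable lborel (\<lambda>z. indicator {z. 0 < v z} z *\<^sub>R v z)"
        by (intro integrable_mult_indicator v) simp
    qed (use 0 in \<open>auto simp: set_lebesgue_integral_def indicator_def\<close>)
    then show ?thesis by eventually_elim (auto simp: indicator_def)
  qed
  have "AE z in lborel. \<not> 0 < w z" by (intro half w zero) simp
  moreover have "AE z in lborel. \<not> 0 < - w z"
  proof (intro half)
    have "(LINT z:{z. 0 < - w z}|lborel. - w z) = - (LINT z:{z. 0 < - w z}|lborel. w z)"
      unfolding set_lebesgue_integral_def by simp
    also have "\<dots> = 0" by (subst zero) auto
    finally show "(LINT z:{z. 0 < - w z}|lborel. - w z) = 0" .
  qed (use w in simp)
  ultimately show ?thesis by eventually_elim auto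
qed

text \<open>The indicator of a closed set is a pointwise limit of continuous functions with values
  between 0 and 1, so dominated convergence reduces the claim to integrals over closed sets.\<close>

lemma AE_zero_if_integral_continuous_zero:
  fixes w :: "'a :: euclidean_space \<Rightarrow> real"
  assumes w [measurable]: "integrable lborel w"
    and cont0: "\<And>\<phi>. continuous_on UNIV \<phi> \<Longrightarrow> (LINT z|lborel. \<phi> z * w z) = 0"
  shows "AE z in lborel. w z = 0"
proof (rule AE_zero_if_integral_closed_zero[OF w])
  fix C :: "'a set" assume C: "closed C"
  show "(LINT z:C|lborel. w z) = 0"
  \<comment> \<open>The empty set is separate because \<open>infdist z {} = 0\<close> by convention,
    which would make every \<open>\<phi> n\<close> equal to 1.\<close>
  proof (cases "C = {}")
    case False
    define \<phi> where "\<phi> = (\<lambda>(n::nat) z. max 0 (1 - n * infdist z C))"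
    have \<phi>: "continuous_on UNIV (\<phi> n)" for n unfolding \<phi>_def by (intro continuous_intros)
    have [measurable]: "\<phi> n \<in> borel_measurable borel" for n
      by (rule borel_measurable_continuous_onI[OF \<phi>])
    have lim: "(\<lambda>n. \<phi> n z) \<longlonglongrightarrow> indicator C z" for z
    proof (cases "z \<in> C")
      case True then show ?thesis by (simp add: \<phi>_def)
    next
      case z: False
      then have "0 < infdist z C" using C False by (metis infdist_nonneg in_closed_iff_infdist_zero less_eq_real_def)
      then have "\<forall>\<^sub>F n in sequentially. 1 / infdist z C < real n"
        using eventually_gt_at_top filterlim_real_sequentially by (metis eventually_compose_filterlim)
      then have "\<forall>\<^sub>F n in sequentially. \<phi> n z = 0"
        by eventually_elim (use \<open>0 < infdist z C\<close> in \<open>simp add: \<phi>_def field_simps\<close>)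
      then show ?thesis using z by (simp add: tendsto_eventually)
    qed
    have "(\<lambda>n. LINT z|lborel. \<phi> n z * w z) \<longlonglongrightarrow> (LINT z|lborel. indicator C z * w z)"
    proof (rule integral_dominated_convergence[where w = "\<lambda>z. norm (w z)"])
      fix n show "AE z in lborel. norm (\<phi> n z * w z) \<le> norm (w z)"
      proof (rule AE_I2)
        fix z have "\<bar>\<phi> n z\<bar> \<le> 1" by (auto simp: \<phi>_def infdist_nonneg)
        then show "norm (\<phi> n z * w z) \<le> norm (w z)" by (simp add: abs_mult mult_left_le_one_le)
      qed
    qed (use C w lim in \<open>auto intro!: tendsto_mult_right borel_closed\<close>)
    then show ?thesis by (simp add: cont0[OF \<phi>] set_lebesgue_integral_def LIMSEQ_const_iff)
  qed (simp add: set_lebesgue_integral_def)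
qed

text \<open>Here \<open>fst z\<close> and \<open>snd z - a * fst z - c\<close> are affine
  coordinates of the plane, so their monomials span all polynomials, which are uniformly dense in
  the continuous functions on \<open>S\<close>.\<close>

lemma AE_zero_if_moments_zero:
  fixes w :: "plane \<Rightarrow> real"
  assumes w: "integrable lborel w" and S: "compact S" "\<And>z. z \<notin> S \<Longrightarrow> w z = 0"
    and mom: "\<And>j m. (LINT z|lborel. fst z ^ j * (snd z - a * fst z - c) ^ m * w z) = 0"
  shows "AE z in lborel. w z = 0"
proof (rule AE_zero_if_integral_continuous_zero[OF w])
  define u :: "plane \<Rightarrow> real" where "u = (\<lambda>z. snd z - a * fst z - c)"
  \<comment> \<open>\<open>W\<close> collects the functions on \<open>S\<close> with vanishing
    moments. It is closed under linear combinations and under multiplication by both coordinates,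
    hence by every polynomial.\<close>
  define W where "W = {v. integrable lborel v \<and> (\<forall>z. z \<notin> S \<longrightarrow> v z = 0) \<and>
    (\<forall>j m. (LINT z|lborel. fst z ^ j * u z ^ m * v z) = 0)}"
  have int: "integrable lborel (\<lambda>z. \<psi> z * v z)" if "v \<in> W" "continuous_on UNIV \<psi>" for v \<psi>
  proof -
    have "integrable lborel (\<lambda>z. \<psi> z *\<^sub>R v z)"
      using that S(1) unfolding W_def by (intro integrable_scaleR_compact_support[of v \<psi> S]) blast+
    then show ?thesis by simp
  qed
  have cont: "continuous_on UNIV (\<lambda>z. fst z ^ j * u z ^ m)" for j m
    unfolding u_def by (intro continuous_intros)
  have W_add: "(\<lambda>z. v z + v' z) \<in> W" if "v \<in> W" "v' \<in> W" for v v'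
    using that int[OF that(1) cont] int[OF that(2) cont] unfolding W_def
    by (auto simp: algebra_simps)
  have W_const: "(\<lambda>z. k * v z) \<in> W" if "v \<in> W" for v k
    using that unfolding W_def by (auto simp: mult.left_commute[of _ k])
  have W_fst: "(\<lambda>z. fst z * v z) \<in> W" if "v \<in> W" for v
  proof -
    have "(LINT z|lborel. fst z ^ j * u z ^ m * (fst z * v z)) = 0" for j m
    proof -
      have "(LINT z|lborel. fst z ^ Suc j * u z ^ m * v z) = 0"
        using that unfolding W_def by blast
      then show ?thesis by (simp add: mult_ac)
    qed
    moreover have "integrable lborel (\<lambda>z. fst z * v z)"
      by (rule int[OF that]) (intro continuous_intros)
    ultimately show ?thesis using that unfolding W_def by auto
  qed
  have W_u: "(\<lambda>z. u z * v z) \<in> W" if "v \<in> W" for v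
  proof -
    have "(LINT z|lborel. fst z ^ j * u z ^ m * (u z * v z)) = 0" for j m
    proof -
      have "(LINT z|lborel. fst z ^ j * u z ^ Suc m * v z) = 0"
        using that unfolding W_def by blast
      then show ?thesis by (simp add: mult_ac)
    qed
    moreover have "integrable lborel (\<lambda>z. u z * v z)"
      by (rule int[OF that]) (unfold u_def, intro continuous_intros)
    ultimately show ?thesis using that unfolding W_def by auto
  qed
  have W_poly: "(\<lambda>z. P z * v z) \<in> W" if "real_polynomial_function P" "v \<in> W" for P v
    using that
  proof (induction P arbitrary: v)
    case (linear f)
    \<comment> \<open>A linear functional is rewritten in the new coordinates through
      \<open>snd z = u z + a * fst z + c\<close>.\<close>
    have f: "f z = (f (1, 0) + f (0, 1) * a) * fst z + f (0, 1) * u z + f (0, 1) * c" for z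
    proof -
      interpret f: bounded_linear f by (rule linear(1))
      have "f z = f (fst z *\<^sub>R (1, 0) + snd z *\<^sub>R (0, 1))" by simp
      also have "\<dots> = fst z * f (1, 0) + snd z * f (0, 1)" by (simp only: f.add f.scaleR real_scaleR_def)
      finally show ?thesis by (simp add: u_def algebra_simps)
    qed
    have "(\<lambda>z. (f (1, 0) + f (0, 1) * a) * (fst z * v z) + f (0, 1) * (u z * v z) + f (0, 1) * c * v z) \<in> W"
      by (intro W_add W_const W_fst W_u linear(2))
    moreover have "(\<lambda>z. f z * v z) = (\<lambda>z. (f (1, 0) + f (0, 1) * a) * (fst z * v z) + f (0, 1) * (u z * v z) + f (0, 1) * c * v z)"
      by (rule ext, subst f) (simp add: algebra_simps)
    ultimately show ?case by simp
  next
    case (const k) then show ?case by (rule W_const)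
  next
    case (add P Q)
    have "(\<lambda>z. P z * v z + Q z * v z) \<in> W" by (intro W_add add)
    then show ?case by (simp add: algebra_simps)
  next
    case (mult P Q)
    have "(\<lambda>z. P z * (Q z * v z)) \<in> W" by (intro mult)
    then show ?case by (simp add: algebra_simps)
  qed
  have wW: "w \<in> W" using w S mom unfolding W_def u_def by blast
  fix \<phi> :: "plane \<Rightarrow> real" assume \<phi>: "continuous_on UNIV \<phi>"
  have "\<bar>LINT z|lborel. \<phi> z * w z\<bar> \<le> e * (LINT z|lborel. \<bar>w z\<bar>)" if "0 < e" for e
  proof -
    obtain P where P: "real_polynomial_function P" "\<And>z. z \<in> S \<Longrightarrow> \<bar>\<phi> z - P z\<bar> < e"
      using Stone_Weierstrass_real_polynomial_function[OF S(1) continuous_on_subset[OF \<phi> subset_UNIV] \<open>0 < e\<close>]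
      by metis
    have "(\<lambda>z. P z * w z) \<in> W" by (rule W_poly[OF P(1) wW])
    then have intP: "integrable lborel (\<lambda>z. P z * w z)" and "(LINT z|lborel. fst z ^ 0 * u z ^ 0 * (P z * w z)) = 0"
      unfolding W_def by blast+
    then have "(LINT z|lborel. \<phi> z * w z) = (LINT z|lborel. \<phi> z * w z - P z * w z)"
      using int[OF wW \<phi>] by simp
    also have "\<bar>\<dots>\<bar> \<le> (LINT z|lborel. e * \<bar>w z\<bar>)"
    proof (rule integral_abs_bound_integral)
      fix z show "\<bar>\<phi> z * w z - P z * w z\<bar> \<le> e * \<bar>w z\<bar>"
      proof (cases "z \<in> S")
        case True
        then have "\<bar>\<phi> z - P z\<bar> * \<bar>w z\<bar> \<le> e * \<bar>w z\<bar>" using P(2)[OF True] by (intro mult_right_mono) auto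
        then show ?thesis by (simp add: abs_mult[symmetric] algebra_simps)
      qed (simp add: S(2))
    qed (use int[OF wW \<phi>] intP w in auto)
    finally show ?thesis by simp
  qed
  note bound = this
  show "(LINT z|lborel. \<phi> z * w z) = 0"
  proof (rule ccontr)
    assume "(LINT z|lborel. \<phi> z * w z) \<noteq> 0"
    define A I where "A = \<bar>LINT z|lborel. \<phi> z * w z\<bar>" and "I = (LINT z|lborel. \<bar>w z\<bar>)"
    have A: "0 < A" using \<open>_ \<noteq> 0\<close> unfolding A_def by simp
    have I: "0 \<le> I" unfolding I_def by simp
    \<comment> \<open>This \<open>e\<close> makes the error at most half of \<open>A\<close>; the
      summand 1 guards against division by 0 when \<open>I = 0\<close>.\<close>
    have "A \<le> A / (2 * (I + 1)) * I" using bound[of "A / (2 * (I + 1))"] A I unfolding A_def I_def by simp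
    also have "\<dots> \<le> A / 2" using A I by (simp add: field_simps)
    finally show False using A by simp
  qed
qed

section \<open>Integrals over lines of small slope\<close>

text \<open>For \<open>n \<ge> 1\<close> the truncated power of degree \<open>n + 1\<close> has a
  locally Lipschitz derivative, which yields a quadratic remainder even across the kink at 0. The
  proof is by induction on \<open>n\<close>.\<close>

lemma pos_part_power_taylor:
  fixes R :: real
  assumes "1 \<le> n"
  obtains K :: real where "0 \<le> K"
    and "\<And>u v :: real. \<bar>u\<bar> \<le> R \<Longrightarrow> \<bar>u - v\<bar> \<le> R \<Longrightarrow>
      \<bar>max 0 (u - v) ^ Suc n - max 0 u ^ Suc n + real (Suc n) * v * max 0 u ^ n\<bar> \<le> K * v\<^sup>2"
proof -
  have "\<exists>K\<ge>0::real. \<forall>u v :: real. \<bar>u\<bar> \<le> R \<longrightarrow> \<bar>u - v\<bar> \<le> R \<longrightarrow>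
      \<bar>max 0 (u - v) ^ Suc n - max 0 u ^ Suc n + real (Suc n) * v * max 0 u ^ n\<bar> \<le> K * v\<^sup>2"
    using assms
  proof (induction n rule: dec_induct)
    case base
    have "\<bar>(max 0 (u - v))\<^sup>2 - (max 0 u)\<^sup>2 + 2 * v * max 0 u\<bar> \<le> 1 * v\<^sup>2" for u v :: real
    proof -
      consider "0 \<le> u" "0 \<le> u - v" | "u < 0" "u - v < 0" | "u < 0" "0 \<le> u - v" | "0 \<le> u" "u - v < 0" by linarith
      then show ?thesis
      proof cases
        case 1 then show ?thesis by (simp add: max_def power2_eq_square algebra_simps)
      next
        case 2 then show ?thesis by (simp add: max_def)
      next
        case 3
        then have "(u - v)\<^sup>2 \<le> (- v)\<^sup>2" by (intro power_mono) auto
        with 3 show ?thesis by (simp add: max_def)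
      next
        case 4
        then have "u * u \<le> v * u" by (intro mult_right_mono) auto
        moreover have "2 * (v * u) \<le> u * u + v * v"
          using zero_le_power2[of "v - u"] by (simp add: power2_eq_square algebra_simps)
        moreover have "0 \<le> u * u" "0 \<le> v * v" by auto
        ultimately have "\<bar>2 * (v * u) - u * u\<bar> \<le> v * v" by (intro abs_leI) linarith+
        with 4 show ?thesis by (simp add: max_def power2_eq_square mult_ac)
      qed
    qed
    then show ?case by (intro exI[of _ 1]) (auto simp: numeral_2_eq_2)
  next
    case (step n)
    then obtain K :: real where K: "0 \<le> K" "\<And>u v :: real. \<bar>u\<bar> \<le> R \<Longrightarrow> \<bar>u - v\<bar> \<le> R \<Longrightarrow>
      \<bar>max 0 (u - v) ^ Suc n - max 0 u ^ Suc n + real (Suc n) * v * max 0 u ^ n\<bar> \<le> K * v\<^sup>2" by auto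
    show ?case
    proof (intro exI[of _ "\<bar>R\<bar> * K + (n + 2) * \<bar>R\<bar> ^ n"] conjI allI impI)
      fix u v :: real assume uv: "\<bar>u\<bar> \<le> R" "\<bar>u - v\<bar> \<le> R"
      define s t where "s = max 0 u" and "t = max 0 (u - v)"
      have s: "0 \<le> s" "s \<le> \<bar>R\<bar>" and t: "0 \<le> t" "t \<le> \<bar>R\<bar>" using uv by (auto simp: s_def t_def)
      have st: "\<bar>s - t\<bar> \<le> \<bar>v\<bar>" by (auto simp: s_def t_def)
      \<comment> \<open>The factor \<open>t - s + v\<close> vanishes if neither maximum truncates,
        and \<open>s = 0\<close> if the one in \<open>s\<close> does. Only truncation in
        \<open>t\<close> alone matters, and then \<open>0 < s \<le> v\<close>.\<close>
      have "\<bar>s * (t - s + v)\<bar> \<le> v\<^sup>2"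
      proof (cases "0 < s \<and> t = 0")
        case True
        then have "0 < s" "s \<le> v" by (auto simp: s_def t_def)
        then have "s * (v - s) \<le> v * v" by (intro mult_mono) auto
        then show ?thesis using True \<open>s \<le> v\<close> by (simp add: abs_mult power2_eq_square)
      next
        case False
        then have "s = 0 \<or> t - s + v = 0" by (auto simp: s_def t_def)
        then show ?thesis by auto
      qed
      then have "\<bar>R\<bar> ^ n * \<bar>s * (t - s + v)\<bar> \<le> \<bar>R\<bar> ^ n * v\<^sup>2" by (intro mult_left_mono) auto
      moreover have "s ^ n * \<bar>s * (t - s + v)\<bar> \<le> \<bar>R\<bar> ^ n * \<bar>s * (t - s + v)\<bar>"
        using s by (intro mult_right_mono power_mono) auto
      ultimately have 1: "\<bar>s ^ Suc n * (t - s + v)\<bar> \<le> \<bar>R\<bar> ^ n * v\<^sup>2"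
        using s by (simp add: abs_mult mult_ac)
      have "\<bar>v * (s - t)\<bar> \<le> v\<^sup>2"
        using st by (simp add: abs_mult power2_eq_square) (metis abs_ge_zero abs_mult_self_eq mult_left_mono)
      then have "s ^ n * \<bar>v * (s - t)\<bar> \<le> \<bar>R\<bar> ^ n * v\<^sup>2"
        using s by (intro mult_mono power_mono) auto
      then have "real (Suc n) * (s ^ n * \<bar>v * (s - t)\<bar>) \<le> real (Suc n) * (\<bar>R\<bar> ^ n * v\<^sup>2)"
        by (intro mult_left_mono) auto
      then have 2: "\<bar>real (Suc n) * v * s ^ n * (s - t)\<bar> \<le> real (Suc n) * (\<bar>R\<bar> ^ n * v\<^sup>2)"
        using s by (simp add: abs_mult mult_ac)
      have 3: "\<bar>t * (t ^ Suc n - s ^ Suc n + real (Suc n) * v * s ^ n)\<bar> \<le> \<bar>R\<bar> * (K * v\<^sup>2)"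
        using K(2)[OF uv] t unfolding abs_mult s_def[symmetric] t_def[symmetric]
        by (intro mult_mono) auto
      \<comment> \<open>The new remainder is \<open>t\<close> times the old one plus two
        corrections, each of order \<open>v\<^sup>2\<close> by the estimates above.\<close>
      have "t ^ Suc (Suc n) - s ^ Suc (Suc n) + real (Suc (Suc n)) * v * s ^ Suc n =
        t * (t ^ Suc n - s ^ Suc n + real (Suc n) * v * s ^ n) + s ^ Suc n * (t - s + v) + real (Suc n) * v * s ^ n * (s - t)"
        by (simp add: algebra_simps)
      also have "\<bar>\<dots>\<bar> \<le> \<bar>R\<bar> * (K * v\<^sup>2) + \<bar>R\<bar> ^ n * v\<^sup>2 + real (Suc n) * (\<bar>R\<bar> ^ n * v\<^sup>2)"
        using 1 2 3 by linarith
      also have "\<dots> = (\<bar>R\<bar> * K + (n + 2) * \<bar>R\<bar> ^ n) * v\<^sup>2" by (simp add: algebra_simps)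
      finally show "\<bar>max 0 (u - v) ^ Suc (Suc n) - max 0 u ^ Suc (Suc n) + real (Suc (Suc n)) * v * max 0 u ^ Suc n\<bar>
        \<le> (\<bar>R\<bar> * K + (n + 2) * \<bar>R\<bar> ^ n) * v\<^sup>2"
        unfolding s_def t_def .
    qed (use K(1) in auto)
  qed
  then show ?thesis using that by blast
qed

text \<open>For \<open>j = 0\<close>, Fubini along lines of slope \<open>a\<close> turns this into
  the line integrals of \<open>g\<close> weighted by \<open>max 0 (b - c) ^ n\<close>; the powers of
  \<open>fst z\<close> come from differentiating in the slope.\<close>

definition tilted_moment :: "(plane \<Rightarrow> complex) \<Rightarrow> real \<Rightarrow> nat \<Rightarrow> nat \<Rightarrow> real \<Rightarrow> complex" where
  "tilted_moment g c j n a = (LINT z|lborel. (fst z ^ j * max 0 (snd z - a * fst z - c) ^ n) *\<^sub>R g z)"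

text \<open>The derivative of the \<open>j\<close>-th moment in the slope is a multiple of the next one. Slopes at which
  the moments vanish need only accumulate from the right, since they are known for almost every
  slope only.\<close>

lemma tilted_moment_Suc_zero:
  fixes g :: "plane \<Rightarrow> complex"
  assumes g: "integrable lborel g" and supp: "\<And>z. g z \<noteq> 0 \<Longrightarrow> z \<in> cbox (0, 0) (2, 1)"
    and n: "1 \<le> n" and a: "tilted_moment g c j (Suc n) a = 0"
    and near: "\<And>\<eta>. 0 < \<eta> \<Longrightarrow> \<exists>a'. a < a' \<and> a' < a + \<eta> \<and> tilted_moment g c j (Suc n) a' = 0"
  shows "tilted_moment g c (Suc j) n a = 0"
proof -
  \<comment> \<open>On the support \<open>0 \<le> x \<le> 2\<close> and
    \<open>0 \<le> y \<le> 1\<close>, so \<open>R\<close> bounds \<open>y - a * x - c\<close> and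
    also its change by \<open>h * x\<close> with \<open>0 < h < 1\<close>.\<close>
  define R where "R = 2 * \<bar>a\<bar> + 3 + \<bar>c\<bar>"
  obtain K :: real where K: "0 \<le> K" "\<And>u v :: real. \<bar>u\<bar> \<le> R \<Longrightarrow> \<bar>u - v\<bar> \<le> R \<Longrightarrow>
      \<bar>max 0 (u - v) ^ Suc n - max 0 u ^ Suc n + real (Suc n) * v * max 0 u ^ n\<bar> \<le> K * v\<^sup>2"
    using pos_part_power_taylor[OF n] by metis
  have int: "integrable lborel (\<lambda>z. \<phi> z *\<^sub>R g z)" if "continuous_on UNIV \<phi>" for \<phi> :: "plane \<Rightarrow> real"
    using supp by (intro integrable_scaleR_compact_support[OF g that compact_cbox]) blast
  \<comment> \<open>\<open>D h\<close> is the Taylor remainder of the moment weight when the slope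
    grows by \<open>h\<close>, that is, when the argument drops by \<open>h * fst z\<close>.\<close>
  define D :: "real \<Rightarrow> plane \<Rightarrow> real" where "D = (\<lambda>(h :: real) (z :: plane). fst z ^ j * (max 0 (snd z - (a + h) * fst z - c) ^ Suc n
    - max 0 (snd z - a * fst z - c) ^ Suc n + real (Suc n) * (h * fst z) * max 0 (snd z - a * fst z - c) ^ n))"
  define I where "I = (LINT z|lborel. norm (g z))"
  have main: "norm (tilted_moment g c (Suc j) n a) \<le> 2 ^ j * K * 4 * I * h"
    if "0 < h" "h < 1" and h0: "tilted_moment g c j (Suc n) (a + h) = 0" for h
  proof -
    have i1: "integrable lborel (\<lambda>z. (fst z ^ j * max 0 (snd z - b * fst z - c) ^ m) *\<^sub>R g z)" for b j m
      by (intro int continuous_intros)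
    have "(\<lambda>z. D h z *\<^sub>R g z) = (\<lambda>z. (fst z ^ j * max 0 (snd z - (a + h) * fst z - c) ^ Suc n) *\<^sub>R g z
       - (fst z ^ j * max 0 (snd z - a * fst z - c) ^ Suc n) *\<^sub>R g z
       + (real (Suc n) * h) *\<^sub>R ((fst z ^ Suc j * max 0 (snd z - a * fst z - c) ^ n) *\<^sub>R g z))"
      unfolding D_def by (rule ext) (simp add: algebra_simps flip: scaleR_add_left scaleR_diff_left)
    then have "(LINT z|lborel. D h z *\<^sub>R g z) = tilted_moment g c j (Suc n) (a + h)
       - tilted_moment g c j (Suc n) a + (real (Suc n) * h) *\<^sub>R tilted_moment g c (Suc j) n a"
      unfolding tilted_moment_def using i1 by (simp del: power_Suc scaleR_scaleR)
    then have "real (Suc n) * h * norm (tilted_moment g c (Suc j) n a) = norm (LINT z|lborel. D h z *\<^sub>R g z)"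
      using a h0 \<open>0 < h\<close> by simp
    also have "\<dots> \<le> (LINT z|lborel. 2 ^ j * (K * (h * 2)\<^sup>2) * norm (g z))"
    proof (rule Bochner_Integration.integral_norm_bound_integral)
      show "integrable lborel (\<lambda>z. D h z *\<^sub>R g z)"
        by (rule int) (unfold D_def, intro continuous_intros)
      fix z show "norm (D h z *\<^sub>R g z) \<le> 2 ^ j * (K * (h * 2)\<^sup>2) * norm (g z)"
      proof (cases "g z = 0")
        case False
        obtain x y where z: "z = (x, y)" by (cases z)
        have xy: "0 \<le> x" "x \<le> 2" "0 \<le> y" "y \<le> 1" using supp[OF False] unfolding z by (auto simp: cbox_Pair_eq)
        define u where "u = y - a * x - c"
        have ax: "\<bar>a * x\<bar> \<le> \<bar>a\<bar> * 2" unfolding abs_mult using xy by (intro mult_left_mono) auto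
        have "h * x \<le> 1 * 2" using xy \<open>0 < h\<close> \<open>h < 1\<close> by (intro mult_mono) auto
        then have hx: "0 \<le> h * x" "h * x \<le> 2" using xy \<open>0 < h\<close> by auto
        have "\<bar>u\<bar> \<le> R" "\<bar>u - h * x\<bar> \<le> R" using ax hx xy unfolding u_def R_def by auto
        from K(2)[OF this] have "\<bar>max 0 (u - h * x) ^ Suc n - max 0 u ^ Suc n + real (Suc n) * (h * x) * max 0 u ^ n\<bar> \<le> K * (h * x)\<^sup>2" .
        also have "\<dots> \<le> K * (h * 2)\<^sup>2" using xy K(1) \<open>0 < h\<close> by (intro mult_left_mono power_mono) auto
        finally have "x ^ j * \<bar>max 0 (u - h * x) ^ Suc n - max 0 u ^ Suc n + real (Suc n) * (h * x) * max 0 u ^ n\<bar> \<le> 2 ^ j * (K * (h * 2)\<^sup>2)"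
          using xy by (intro mult_mono power_mono) auto
        moreover have "y - (a + h) * x - c = u - h * x" "y - a * x - c = u" by (simp_all add: u_def algebra_simps)
        then have "D h z = x ^ j * (max 0 (u - h * x) ^ Suc n - max 0 u ^ Suc n + real (Suc n) * (h * x) * max 0 u ^ n)"
          by (simp only: D_def z fst_conv snd_conv)
        ultimately have "\<bar>D h z\<bar> \<le> 2 ^ j * (K * (h * 2)\<^sup>2)"
          using xy(1) by (simp only: abs_mult power_abs abs_of_nonneg)
        then show ?thesis by (auto intro: mult_right_mono)
      qed simp
    qed (use g in simp)
    \<comment> \<open>The bound is quadratic in \<open>h\<close>, the left side linear. Cancelling
      one \<open>h\<close> leaves a bound that tends to 0 with \<open>h\<close>.\<close>
    also have "\<dots> = h * (2 ^ j * K * 4 * I * h)" by (simp add: I_def power2_eq_square)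
    finally have "h * (real (Suc n) * norm (tilted_moment g c (Suc j) n a)) \<le> h * (2 ^ j * K * 4 * I * h)"
      by (simp add: mult_ac)
    then have "real (Suc n) * norm (tilted_moment g c (Suc j) n a) \<le> 2 ^ j * K * 4 * I * h"
      using \<open>0 < h\<close> by (rule mult_left_le_imp_le)
    moreover have "1 * norm (tilted_moment g c (Suc j) n a) \<le> real (Suc n) * norm (tilted_moment g c (Suc j) n a)"
      by (intro mult_right_mono) auto
    ultimately show ?thesis by linarith
  qed
  define B where "B = 2 ^ j * K * 4 * I"
  have B: "0 \<le> B" using K(1) unfolding B_def I_def by simp
  show ?thesis
  proof (rule ccontr)
    assume "\<not> ?thesis"
    then have pos: "0 < norm (tilted_moment g c (Suc j) n a)" (is "0 < ?A") by simp
    define \<eta> where "\<eta> = min 1 (?A / (B + 1))"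
    have "0 < \<eta>" using pos B unfolding \<eta>_def by simp
    then obtain a' where a': "a < a'" "a' < a + \<eta>" "tilted_moment g c j (Suc n) a' = 0" using near by blast
    have "?A \<le> B * (a' - a)" using main[of "a' - a"] a' unfolding B_def \<eta>_def by simp
    also have "\<dots> \<le> B * \<eta>" using a' B by (intro mult_left_mono) auto
    also have "\<dots> \<le> B * (?A / (B + 1))" using B unfolding \<eta>_def by (intro mult_left_mono) auto
    also have "\<dots> < ?A" using pos B by (simp add: field_simps)
    finally show False by simp
  qed
qed

text \<open>The moment criterion is applied to \<open>max 0 u\<close> times the real or imaginary
  part of \<open>g\<close>. The extra factor raises the exponent by one, so exponents from 1 on are
  exactly what enters, and it is positive above the line.\<close>

lemma AE_zero_above_tilted_line:
  fixes g :: "plane \<Rightarrow> complex"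
  assumes g: "integrable lborel g" and supp: "\<And>z. g z \<noteq> 0 \<Longrightarrow> z \<in> cbox (0, 0) (2, 1)"
    and mom: "\<And>j n. 1 \<le> n \<Longrightarrow> tilted_moment g c j n a = 0"
  shows "AE z in lborel. c < snd z - a * fst z \<longrightarrow> g z = 0"
proof -
  define u :: "plane \<Rightarrow> real" where "u = (\<lambda>z. snd z - a * fst z - c)"
  have u_eq: "snd z - a * fst z - c = u z" for z by (simp add: u_def)
  have u: "continuous_on UNIV u" unfolding u_def by (intro continuous_intros)
  have main: "AE z in lborel. c < snd z - a * fst z \<longrightarrow> p (g z) = 0"
    if p: "bounded_linear p" for p :: "complex \<Rightarrow> real"
  proof -
    interpret p: bounded_linear p by (rule p)
    have int: "integrable lborel (\<lambda>z. \<phi> z *\<^sub>R g z)" if "continuous_on UNIV \<phi>" for \<phi> :: "plane \<Rightarrow> real"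
      using supp by (intro integrable_scaleR_compact_support[OF g that compact_cbox]) blast
    have "AE z in lborel. max 0 (u z) * p (g z) = 0"
    proof (rule AE_zero_if_moments_zero[where S = "cbox (0, 0) (2, 1)" and a = a and c = c])
      have "integrable lborel (\<lambda>z. p (max 0 (u z) *\<^sub>R g z))"
        by (intro integrable_bounded_linear[OF p] int continuous_intros u)
      then show "integrable lborel (\<lambda>z. max 0 (u z) * p (g z))" by (simp add: p.scaleR)
      show "max 0 (u z) * p (g z) = 0" if "z \<notin> cbox (0, 0) (2, 1)" for z
        using supp[of z] that by (cases "g z = 0") (auto simp: p.zero)
      fix j m
      have "(LINT z|lborel. p ((fst z ^ j * max 0 (u z) ^ Suc m) *\<^sub>R g z)) = p (tilted_moment g c j (Suc m) a)"
        unfolding tilted_moment_def u_eq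
        by (rule integral_bounded_linear[OF p int]) (intro continuous_intros u)
      also have "\<dots> = 0" using mom by (simp add: p.zero)
      also have "(\<lambda>z. p ((fst z ^ j * max 0 (u z) ^ Suc m) *\<^sub>R g z))
          = (\<lambda>z. fst z ^ j * (snd z - a * fst z - c) ^ m * (max 0 (u z) * p (g z)))"
        by (rule ext) (auto simp: p.scaleR max_def u_def)
      finally show "(LINT z|lborel. fst z ^ j * (snd z - a * fst z - c) ^ m * (max 0 (u z) * p (g z))) = 0" .
    qed simp
    then show ?thesis by eventually_elim (auto simp: u_def max_def split: if_splits)
  qed
  from main[OF bounded_linear_Re] main[OF bounded_linear_Im] show ?thesis
    by eventually_elim (auto simp: complex_eq_iff)
qed

text \<open>On a line of slope \<open>a\<close> the weight is the constant
  \<open>max 0 (b - c) ^ n\<close> and factors out of the line integral. Since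
  \<open>n \<ge> 1\<close>, it vanishes for \<open>b \<le> c\<close>, where nothing is known about
  the lines.\<close>

lemma tilted_moment_0_zero:
  fixes g :: "plane \<Rightarrow> complex"
  assumes g: "integrable lborel g" and supp: "\<And>z. g z \<noteq> 0 \<Longrightarrow> z \<in> cbox (0, 0) (2, 1)"
    and n: "1 \<le> n" and lines: "AE b in lborel. c < b \<longrightarrow> (LINT x|lborel. g (x, b + a * x)) = 0"
  shows "tilted_moment g c 0 n a = 0"
proof -
  define G where "G = (\<lambda>z. max 0 (snd z - a * fst z - c) ^ n *\<^sub>R g z)"
  have G: "integrable lborel G"
    unfolding G_def using supp
    by (intro integrable_scaleR_compact_support[OF g _ compact_cbox[of "(0, 0)" "(2, 1)"]] continuous_intros) blast
  have "tilted_moment g c 0 n a = integral\<^sup>L lborel G" unfolding tilted_moment_def G_def by simp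
  also have "\<dots> = (LINT b|lborel. LINT x|lborel. G (x, b + a * x))"
    using integral_skew_iterated(2)[OF _ G, of 1 0 a] by simp
  also have "\<dots> = (LINT b|lborel. max 0 (b - c) ^ n *\<^sub>R (LINT x|lborel. g (x, b + a * x)))"
    unfolding G_def by simp
  also have "\<dots> = 0"
    using lines by (intro integral_eq_zero_AE, eventually_elim) (use n in \<open>auto simp: max_def\<close>)
  finally show ?thesis .
qed

text \<open>Induction on \<open>j\<close> for all \<open>n\<close> and all slopes in
  \<open>S\<close> at once: each derivative in the slope trades one power of the truncated factor
  for one power of \<open>x\<close>. Density of \<open>S\<close> supplies slopes accumulating at
  \<open>a\<close> from the right.\<close>

lemma AE_zero_above_if_line_integrals_zero:
  fixes g :: "plane \<Rightarrow> complex"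
  assumes g: "integrable lborel g" and supp: "\<And>z. g z \<noteq> 0 \<Longrightarrow> z \<in> cbox (0, 0) (2, 1)"
    and S: "S \<subseteq> {0<..<\<epsilon>}" and dense: "\<And>l r. 0 \<le> l \<Longrightarrow> l < r \<Longrightarrow> r \<le> \<epsilon> \<Longrightarrow> \<exists>a\<in>S. l < a \<and> a < r"
    and lines: "\<And>a. a \<in> S \<Longrightarrow> AE b in lborel. c < b \<longrightarrow> (LINT x|lborel. g (x, b + a * x)) = 0"
    and a: "a \<in> S"
  shows "AE z in lborel. c < snd z - a * fst z \<longrightarrow> g z = 0"
proof (rule AE_zero_above_tilted_line[OF g supp])
  fix j n :: nat assume "1 \<le> n"
  then show "tilted_moment g c j n a = 0"
    using a
  proof (induction j arbitrary: n a)
    case 0 then show ?case by (intro tilted_moment_0_zero[OF g supp] lines)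
  next
    case (Suc j)
    show ?case
    proof (rule tilted_moment_Suc_zero[OF g supp Suc.prems(1)])
      show "tilted_moment g c j (Suc n) a = 0" using Suc by simp
      fix \<eta> :: real assume "0 < \<eta>"
      then obtain a' where "a' \<in> S" "a < a'" "a' < min (a + \<eta>) \<epsilon>"
        using dense[of a "min (a + \<eta>) \<epsilon>"] Suc.prems(2) S by fastforce
      then show "\<exists>a'. a < a' \<and> a' < a + \<eta> \<and> tilted_moment g c j (Suc n) a' = 0"
        using Suc.IH by (intro exI[of _ a']) auto
    qed
  qed
qed

section \<open>Broken rays close to horizontal ones\<close>

lemma mem_bdry: "(x, y) \<in> bdry \<longleftrightarrow> 0 \<le> x \<and> x \<le> 1 \<and> 0 \<le> y \<and> y \<le> 1 \<and> (x = 0 \<or> x = 1 \<or> y = 0 \<or> y = 1)"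
proof -
  have "open Omega" unfolding Omega_def by (intro open_Times) auto
  then have "bdry = {0..1} \<times> {0..1} - Omega"
    unfolding frontier_def by (simp add: interior_open Omega_def closure_Times)
  then show ?thesis by (auto simp: Omega_def)
qed

lemma convex_between:
  fixes b b' r :: real
  assumes "0 < b" "b < 1" "0 < b'" "b' < 1" "0 \<le> r" "r \<le> 1"
  shows "0 < b + r * (b' - b)" "b + r * (b' - b) < 1"
proof -
  have "(1 - r) *\<^sub>R b + r *\<^sub>R b' \<in> {0<..<1}"
    using assms by (intro convexD_alt) (auto simp: convex_real_interval)
  then show "0 < b + r * (b' - b)" "b + r * (b' - b) < 1" by (auto simp: algebra_simps)
qed

text \<open>Throughout, \<sigma> is the abscissa of a vertical side and
  \<open>1 - 2 * \<sigma>\<close> the sign of the horizontal direction into the square. Heights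
  along the segment stay strictly between 0 and 1, so only its ends can meet the boundary.\<close>

lemma segment_cross_bdry:
  assumes "\<sigma> \<in> {0, 1}" "0 < b" "b < 1" "0 < b'" "b' < 1"
  shows "closed_segment (\<sigma>, b) (1 - \<sigma>, b') \<inter> bdry \<subseteq> {(\<sigma>, b), (1 - \<sigma>, b')}"
proof
  fix z assume z: "z \<in> closed_segment (\<sigma>, b) (1 - \<sigma>, b') \<inter> bdry"
  then obtain r where r: "0 \<le> r" "r \<le> 1" and zr: "z = (\<sigma> + r * (1 - 2 * \<sigma>), b + r * (b' - b))"
    by (auto simp: in_segment algebra_simps)
  from convex_between[OF assms(2-5) r] z have "\<sigma> + r * (1 - 2 * \<sigma>) = 0 \<or> \<sigma> + r * (1 - 2 * \<sigma>) = 1"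
    unfolding zr by (auto simp: mem_bdry)
  then have "r = 0 \<or> r = 1" using assms(1) by auto
  then show "z \<in> {(\<sigma>, b), (1 - \<sigma>, b')}" unfolding zr by auto
qed

text \<open>The crossing takes time \<open>1 / c\<close> and changes the height by the slope
  \<open>s / c\<close>; since the endpoint is not a corner, reflection flips just the horizontal
  component.\<close>

lemma billiard_cross:
  assumes \<sigma>: "\<sigma> \<in> {0, 1}" and c: "0 < c" and b: "0 < b" "b < 1" "0 < b + s / c" "b + s / c < 1"
  shows "billiard ((\<sigma>, b), ((1 - 2 * \<sigma>) * c, s)) = ((1 - \<sigma>, b + s / c), (- ((1 - 2 * \<sigma>) * c), s))"
proof -
  let ?P = "\<lambda>t. 0 < t \<and> (\<sigma>, b) + t *\<^sub>R ((1 - 2 * \<sigma>) * c, s) \<in> bdry"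
  have "exit_time (\<sigma>, b) ((1 - 2 * \<sigma>) * c, s) = 1 / c"
    unfolding exit_time_def
  proof (rule Least_equality)
    show "?P (1 / c)" using \<sigma> c b by (auto simp: mem_bdry)
    fix t assume t: "?P t"
    show "1 / c \<le> t"
    proof (rule ccontr)
      assume "\<not> 1 / c \<le> t"
      then have tc: "0 < t * c" "t * c < 1" using c t by (auto simp: field_simps)
      have "t * s = t * c * (s / c)" using c by simp
      then have "0 < b + t * s" "b + t * s < 1"
        using convex_between[of b "b + s / c" "t * c"] b tc by auto
      then have "\<sigma> + t * c * (1 - 2 * \<sigma>) = 0 \<or> \<sigma> + t * c * (1 - 2 * \<sigma>) = 1"
        using t by (auto simp: mem_bdry mult_ac)
      then show False using tc \<sigma> by auto
    qed
  qed
  moreover have "reflect (1 - \<sigma>, b + s / c) ((1 - 2 * \<sigma>) * c, s) = (- ((1 - 2 * \<sigma>) * c), s)"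
    using \<sigma> b by (auto simp: reflect_def corners_def nu_def)
  moreover have "(\<sigma>, b) + (1 / c) *\<^sub>R ((1 - 2 * \<sigma>) * c, s) = (1 - \<sigma>, b + s / c)"
    using c by simp
  ultimately show ?thesis unfolding billiard_def by (simp only: Let_def prod.case)
qed

lemma vertex_0 [simp]: "vertex z 0 = fst z" and direction_0 [simp]: "direction z 0 = snd z"
  by (simp_all add: vertex_def direction_def)

text \<open>The reflected direction has the initial form with \<sigma> replaced by
  \<open>1 - \<sigma>\<close>, so the second crossing is another instance of the first.\<close>

lemma
  assumes "\<sigma> \<in> {0, 1}" "0 < c" "0 < b" "b < 1" "0 < b + s / c" "b + s / c < 1"
  defines "z \<equiv> ((\<sigma>, b), ((1 - 2 * \<sigma>) * c, s))"
  shows vertex_1_cross: "vertex z (Suc 0) = (1 - \<sigma>, b + s / c)"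
    and direction_1_cross: "direction z (Suc 0) = (- ((1 - 2 * \<sigma>) * c), s)"
    and vertex_2_cross: "0 < b + 2 * (s / c) \<Longrightarrow> b + 2 * (s / c) < 1 \<Longrightarrow>
      vertex z (Suc (Suc 0)) = (\<sigma>, b + 2 * (s / c))"
proof -
  have 1: "billiard z = ((1 - \<sigma>, b + s / c), (- ((1 - 2 * \<sigma>) * c), s))"
    unfolding z_def by (rule billiard_cross[OF assms(1-6)])
  then show "vertex z (Suc 0) = (1 - \<sigma>, b + s / c)" "direction z (Suc 0) = (- ((1 - 2 * \<sigma>) * c), s)"
    by (simp_all add: vertex_def direction_def)
  assume "0 < b + 2 * (s / c)" "b + 2 * (s / c) < 1"
  then have "billiard ((1 - \<sigma>, b + s / c), ((1 - 2 * (1 - \<sigma>)) * c, s))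
      = ((1 - (1 - \<sigma>), b + s / c + s / c), (- ((1 - 2 * (1 - \<sigma>)) * c), s))"
    using assms by (intro billiard_cross) auto
  then show "vertex z (Suc (Suc 0)) = (\<sigma>, b + 2 * (s / c))"
    by (simp add: vertex_def 1 algebra_simps)
qed

lemma Gamma_minus_on_side:
  assumes "\<sigma> \<in> {0, 1}" "0 < c" "0 < b" "b < 1" "c\<^sup>2 + s\<^sup>2 = 1"
  shows "((\<sigma>, b), ((1 - 2 * \<sigma>) * c, s)) \<in> Gamma_minus"
  using assms by (auto simp: Gamma_minus_def mem_bdry corners_def nu_def norm_Pair)

section \<open>Regularity of rays with at most one reflection\<close>

context
  fixes E :: "plane set" and \<sigma> b c s :: real
  assumes E: "openin (top_of_set bdry) E"
    and \<sigma>: "\<sigma> \<in> {0, 1}" and cs: "0 < c" "c\<^sup>2 + s\<^sup>2 = 1"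
    and b: "0 < b" "b < 1" "0 < b + s / c" "b + s / c < 1" "(\<sigma>, b) \<in> E"
begin

text \<open>The only boundary points on the ray are its two ends. Both lie in \<open>E\<close>,
  which is relatively open and so disjoint from its relative boundary.\<close>

lemma regular_no_reflection:
  assumes "(1 - \<sigma>, b + s / c) \<in> E"
  defines "z \<equiv> ((\<sigma>, b), ((1 - 2 * \<sigma>) * c, s))"
  shows "regular E z" and "num_refl E z = 0"
proof -
  have v1: "vertex z (Suc 0) = (1 - \<sigma>, b + s / c)"
    unfolding z_def by (rule vertex_1_cross[OF \<sigma> cs(1) b(1-4)])
  show n: "num_refl E z = 0"
    unfolding num_refl_def by (rule Least_equality) (simp_all add: v1 assms(1))
  have "broken_ray E z = closed_segment (\<sigma>, b) (1 - \<sigma>, b + s / c)"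
    unfolding broken_ray_def n by (simp add: v1) (simp add: z_def)
  moreover have "top_of_set bdry frontier_of E \<subseteq> bdry - E"
    using frontier_of_openin[OF E] frontier_of_subset_topspace[of "top_of_set bdry" E] by auto
  ultimately have "broken_ray E z \<inter> (top_of_set bdry frontier_of E) = {}"
    using segment_cross_bdry[OF \<sigma> b(1-4)] assms(1) b(5) by auto
  then show "regular E z"
    using Gamma_minus_on_side[OF \<sigma> cs(1) b(1,2) cs(2)] b(5) v1 assms(1)
    unfolding regular_def returns_def Gamma_minus_on_def by (auto simp: z_def intro: exI[of _ 0])
qed

text \<open>Requiring the reflection point to avoid the closure of \<open>E\<close>, rather than
  only \<open>E\<close>, keeps it off the relative boundary as well; the outer ends are in
  \<open>E\<close>.\<close>

lemma regular_one_reflection: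
  assumes out: "(1 - \<sigma>, b + s / c) \<notin> top_of_set bdry closure_of E"
    and b2: "0 < b + 2 * (s / c)" "b + 2 * (s / c) < 1" "(\<sigma>, b + 2 * (s / c)) \<in> E"
  defines "z \<equiv> ((\<sigma>, b), ((1 - 2 * \<sigma>) * c, s))"
  shows "regular E z" and "num_refl E z = Suc 0"
proof -
  have v1: "vertex z (Suc 0) = (1 - \<sigma>, b + s / c)"
    unfolding z_def by (rule vertex_1_cross[OF \<sigma> cs(1) b(1-4)])
  have v2: "vertex z (Suc (Suc 0)) = (\<sigma>, b + 2 * (s / c))"
    unfolding z_def by (rule vertex_2_cross[OF \<sigma> cs(1) b(1-4) b2(1,2)])
  have "(1 - \<sigma>, b + s / c) \<notin> E"
    using out closure_of_subset[OF openin_subset[OF E]] by auto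
  then have "vertex z (Suc n) \<in> E \<Longrightarrow> Suc 0 \<le> n" for n using v1 by (cases n) auto
  then show n: "num_refl E z = Suc 0"
    unfolding num_refl_def using b2(3) by (intro Least_equality) (simp_all only: v2)
  have "broken_ray E z = closed_segment (\<sigma>, b) (1 - \<sigma>, b + s / c)
      \<union> closed_segment (1 - \<sigma>, b + s / c) (1 - (1 - \<sigma>), b + 2 * (s / c))"
    unfolding broken_ray_def n by (simp add: v1 v2 atMost_Suc Un_commute) (simp add: z_def)
  moreover have "closed_segment (1 - \<sigma>, b + s / c) (1 - (1 - \<sigma>), b + 2 * (s / c)) \<inter> bdry
      \<subseteq> {(1 - \<sigma>, b + s / c), (\<sigma>, b + 2 * (s / c))}"
    using segment_cross_bdry[of "1 - \<sigma>" "b + s / c" "b + 2 * (s / c)"] \<sigma> b b2 by auto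
  moreover have "top_of_set bdry frontier_of E \<subseteq> bdry - E"
    using frontier_of_openin[OF E] frontier_of_subset_topspace[of "top_of_set bdry" E] by auto
  moreover have "(1 - \<sigma>, b + s / c) \<notin> top_of_set bdry frontier_of E"
    using out unfolding frontier_of_def by auto
  ultimately have "broken_ray E z \<inter> (top_of_set bdry frontier_of E) = {}"
    using segment_cross_bdry[OF \<sigma> b(1-4)] b2(3) b(5) by auto
  then show "regular E z"
    using Gamma_minus_on_side[OF \<sigma> cs(1) b(1,2) cs(2)] b(5) v2 b2(3)
    unfolding regular_def returns_def Gamma_minus_on_def by (auto simp: z_def intro: exI[of _ "Suc 0"])
qed

end

lemma openin_bdry_side:
  assumes "openin (top_of_set bdry) U" "(\<sigma>, q) \<in> U" "\<sigma> \<in> {0, 1}" "0 < q" "q < 1"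
  obtains \<delta> where "0 < \<delta>" "\<And>b. \<bar>b - q\<bar> < \<delta> \<Longrightarrow> (\<sigma>, b) \<in> U \<and> 0 < b \<and> b < 1"
proof -
  obtain V where V: "open V" "U = bdry \<inter> V" using assms(1) by (auto simp: openin_open)
  then obtain e where e: "0 < e" "ball (\<sigma>, q) e \<subseteq> V" using assms(2) openE by blast
  show ?thesis
  proof
    show "0 < min e (min q (1 - q))" using e assms by auto
    fix b assume b: "\<bar>b - q\<bar> < min e (min q (1 - q))"
    then have "(\<sigma>, b) \<in> ball (\<sigma>, q) e" by (simp add: dist_Pair_Pair dist_real_def abs_minus_commute)
    then show "(\<sigma>, b) \<in> U \<and> 0 < b \<and> b < 1" using b e(2) V(2) assms(3) by (auto simp: mem_bdry)
  qed
qed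

text \<open>So a broken ray that is horizontal somewhere is horizontal everywhere.\<close>

lemma abs_snd_direction: "\<bar>snd (direction z j)\<bar> = \<bar>snd (snd z)\<bar>"
proof (induction j)
  case (Suc j)
  have "\<bar>snd (reflect x \<theta>)\<bar> = \<bar>snd \<theta>\<bar>" for x \<theta>
    by (cases \<theta>) (auto simp: reflect_def nu_def)
  then have "\<bar>snd (snd (billiard w))\<bar> = \<bar>snd (snd w)\<bar>" for w
    by (simp add: billiard_def Let_def split: prod.split)
  then show ?case using Suc by (simp add: direction_def)
qed simp

text \<open>A horizontal direction is tangential on the horizontal sides, and from a corner it never
  enters the open square, so the start is inside a vertical side.\<close>

lemma horizontal_Gamma_minus:
  assumes "z \<in> Gamma_minus" "snd (snd z) = 0"
  obtains \<sigma> q where "\<sigma> \<in> {0, 1}" "0 < q" "q < 1" "z = ((\<sigma>, q), (1 - 2 * \<sigma>, 0))"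
proof -
  obtain x y c where z: "z = ((x, y), (c, 0))" using assms(2) by (cases z) auto
  have bd: "(x, y) \<in> bdry" and c: "\<bar>c\<bar> = 1" using assms(1) by (auto simp: z Gamma_minus_def norm_Pair)
  have "\<not> (x, y) \<in> corners"
  proof
    assume xy: "(x, y) \<in> corners"
    then obtain e where "0 < e" and e: "\<And>t. 0 < t \<Longrightarrow> t < e \<Longrightarrow> (x, y) + t *\<^sub>R (c, 0) \<in> Omega"
      using assms(1) by (auto simp: z Gamma_minus_def)
    then have "(x, y) + (e / 2) *\<^sub>R (c, 0) \<in> Omega" using e[of "e / 2"] by simp
    then show False using xy by (auto simp: Omega_def corners_def)
  qed
  then have "nu (x, y) \<bullet> (c, 0) < 0" and nc: "\<not> (x, y) \<in> corners" using assms(1) by (auto simp: z Gamma_minus_def)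
  then have "(x = 0 \<and> 0 < c) \<or> (x = 1 \<and> c < 0)" by (auto simp: nu_def split: if_splits)
  then have "x \<in> {0, 1}" "c = 1 - 2 * x" using c by auto
  moreover have "0 < y" "y < 1"
    using bd nc \<open>x \<in> {0, 1}\<close> by (auto simp: mem_bdry corners_def order_less_le)
  ultimately show ?thesis using that z by blast
qed

lemma vertex_horizontal:
  assumes "\<sigma> \<in> {0, 1}" "0 < q" "q < 1"
  shows "\<exists>\<rho>\<in>{0, 1}. (billiard ^^ j) ((\<sigma>, q), (1 - 2 * \<sigma>, 0)) = ((\<rho>, q), (1 - 2 * \<rho>, 0))"
proof (induction j)
  case (Suc j)
  then obtain \<rho> where \<rho>: "\<rho> \<in> {0, 1}" "(billiard ^^ j) ((\<sigma>, q), (1 - 2 * \<sigma>, 0)) = ((\<rho>, q), (1 - 2 * \<rho>, 0))" by blast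
  have "billiard ((\<rho>, q), (1 - 2 * \<rho>, 0)) = ((1 - \<rho>, q), (1 - 2 * (1 - \<rho>), 0))"
    using billiard_cross[of \<rho> 1 q 0] \<rho>(1) assms by auto
  then show ?case using \<rho> by (intro bexI[of _ "1 - \<rho>"]) auto
qed (use assms in auto)

text \<open>The conormal direction \<open>(0, 1)\<close> yields a horizontal regular ray through
  \<open>(p, q)\<close>, which bounces between the points of height \<open>q\<close> on the vertical
  sides. If the opposite point is not in \<open>E\<close>, it is a reflection point, and regularity
  keeps it off the relative boundary of \<open>E\<close>.\<close>

lemma visible_horizontal:
  assumes "openin (top_of_set bdry) E" "(p, q) \<in> visible E N"
  obtains \<sigma> where "\<sigma> \<in> {0, 1}" "0 < q" "q < 1" "(\<sigma>, q) \<in> E"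
    "(1 - \<sigma>, q) \<in> E \<or> (1 - \<sigma>, q) \<notin> top_of_set bdry closure_of E"
proof -
  have "(0, 1) \<in> sphere (0 :: plane) 1" by (simp add: norm_Pair)
  then obtain z where reg: "regular E z" and "((p, q), (0, 1)) \<in> conormal E z"
    using assms(2) unfolding visible_def by blast
  then obtain j where seg: "(p, q) \<in> open_segment (vertex z j) (vertex z (Suc j))"
    and "snd (direction z j) = 0"
    unfolding conormal_def by (auto simp: inner_prod_def)
  then have "snd (snd z) = 0" using abs_snd_direction[of z j] by simp
  then obtain \<sigma> q' where \<sigma>: "\<sigma> \<in> {0, 1}" and q': "0 < q'" "q' < 1" and z: "z = ((\<sigma>, q'), (1 - 2 * \<sigma>, 0))"
    using reg horizontal_Gamma_minus unfolding regular_def Gamma_minus_on_def by blast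
  have "snd (vertex z i) = q'" for i
    unfolding vertex_def z using vertex_horizontal[OF \<sigma> q', of i] by auto
  then have q: "q = q'" using seg by (auto simp: in_segment algebra_simps prod_eq_iff)
  have E: "(\<sigma>, q) \<in> E" using reg unfolding regular_def Gamma_minus_on_def z q by simp
  have v1: "vertex z (Suc 0) = (1 - \<sigma>, q)"
    using vertex_1_cross[of \<sigma> 1 q 0] \<sigma> q q' unfolding z by simp
  have "(1 - \<sigma>, q) \<in> E \<or> (1 - \<sigma>, q) \<notin> top_of_set bdry closure_of E"
  proof (cases "(1 - \<sigma>, q) \<in> E")
    case False
    have "num_refl E z \<noteq> 0"
    proof
      assume "num_refl E z = 0"
      then have "vertex z (Suc 0) \<in> E"
        using reg unfolding regular_def returns_def num_refl_def by (metis LeastI_ex)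
      then show False using False v1 by simp
    qed
    then have "vertex z (Suc 0) \<in> broken_ray E z"
      unfolding broken_ray_def by (intro UN_I[of "Suc 0"]) auto
    then have "(1 - \<sigma>, q) \<notin> top_of_set bdry frontier_of E" using reg v1 unfolding regular_def by auto
    then show ?thesis using False frontier_of_openin[OF assms(1)] by auto
  qed simp
  then show ?thesis using that \<sigma> q q' E by blast
qed

section \<open>Almost every ray and the transform\<close>

lemma lborel_distr_isometry:
  fixes \<tau> :: real
  assumes "\<bar>\<tau>\<bar> = 1"
  shows "distr lborel lborel (\<lambda>x. p + \<tau> * x) = lborel"
proof -
  have "lborel = density (distr lborel borel (\<lambda>x. p + \<tau> * x)) (\<lambda>_. 1)"
    using lborel_real_affine[of \<tau> p] assms by auto
  then show ?thesis by (metis density_1 distr_cong sets_lborel)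
qed

lemma AE_lborel_isometry:
  fixes \<tau> :: real
  assumes "\<bar>\<tau>\<bar> = 1" "AE x in lborel. P x"
  shows "AE x in lborel. P (p + \<tau> * x)"
proof (rule AE_distrD[of "\<lambda>x. p + \<tau> * x" lborel lborel])
  show "AE x in distr lborel lborel (\<lambda>x. p + \<tau> * x). P x"
    unfolding lborel_distr_isometry[OF assms(1)] by (rule assms(2))
qed simp

lemma AE_lborel_dense:
  fixes l r :: real
  assumes "AE x in lborel. P x" "l < r"
  obtains x where "l < x" "x < r" "P x"
proof -
  have no: "\<not> (AE x in lborel. x \<notin> {l<..<r})"
    using assms(2) by (subst AE_iff_measurable[of "{l<..<r}"]) auto
  have "\<exists>x. l < x \<and> x < r \<and> P x"
  proof (rule ccontr)
    assume "\<nexists>x. l < x \<and> x < r \<and> P x"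
    then have "AE x in lborel. x \<notin> {l<..<r}" by (intro eventually_mono[OF assms(1)]) auto
    with no show False by contradiction
  qed
  then show ?thesis using that by blast
qed

text \<open>The product null set is pulled back to arc length and angle, direction outermost: for
  almost every angle the bad starting points form a null set.\<close>

lemma AE_bdry_circle:
  assumes "AE z in bdry_measure \<Otimes>\<^sub>M circle_measure. P z"
  shows "AE \<alpha> in lborel. \<alpha> \<in> {0..<2 * pi} \<longrightarrow>
    (AE s in lborel. s \<in> {0..<4} \<longrightarrow> P (perimeter s, (cos \<alpha>, sin \<alpha>)))"
proof -
  have per: "perimeter \<in> restrict_space lborel {0..<4} \<rightarrow>\<^sub>M borel"
    unfolding perimeter_def by (intro measurable_restrict_space1) (simp add: borel_prod[symmetric])
  have cs: "(\<lambda>\<alpha>. (cos \<alpha>, sin \<alpha>)) \<in> restrict_space lborel {0..<2 * pi} \<rightarrow>\<^sub>M (borel :: plane measure)"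
    by (intro measurable_restrict_space1) (simp add: borel_prod[symmetric])
  have fin: "finite_measure (restrict_space lborel {0..<r})" for r :: real
    by (intro finite_measureI, cases "0 \<le> r") (simp_all add: emeasure_restrict_space space_restrict_space)
  interpret B: finite_measure bdry_measure
    unfolding bdry_measure_def by (intro finite_measure.finite_measure_distr fin per)
  interpret C: finite_measure circle_measure
    unfolding circle_measure_def by (intro finite_measure.finite_measure_distr fin cs)
  interpret pair_sigma_finite bdry_measure circle_measure ..
  have "AE \<theta> in circle_measure. AE x in bdry_measure. P (x, \<theta>)" by (rule AE_pair_swap[OF assms])
  then have "AE \<alpha> in restrict_space lborel {0..<2 * pi}. AE x in bdry_measure. P (x, (cos \<alpha>, sin \<alpha>))"
    unfolding circle_measure_def by (rule AE_distrD[OF cs])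
  then have "AE \<alpha> in lborel. \<alpha> \<in> {0..<2 * pi} \<longrightarrow> (AE x in bdry_measure. P (x, (cos \<alpha>, sin \<alpha>)))"
    by (subst (asm) AE_restrict_space_iff) auto
  moreover have "AE s in lborel. s \<in> {0..<4} \<longrightarrow> P (perimeter s, \<theta>)"
    if "AE x in bdry_measure. P (x, \<theta>)" for \<theta>
    using AE_distrD[OF per that[unfolded bdry_measure_def]] by (subst (asm) AE_restrict_space_iff) auto
  ultimately show ?thesis by (elim eventually_mono) auto
qed

text \<open>Both vertical sides are brought to one form: \<alpha> is the inclination of an upward
  ray entering the square and \<open>b\<close> its starting height.\<close>

lemma AE_bdry_circle_side:
  assumes "AE z in bdry_measure \<Otimes>\<^sub>M circle_measure. P z" and "\<sigma> \<in> {0, 1}"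
  shows "AE \<alpha> in lborel. 0 < \<alpha> \<and> \<alpha> < pi / 2 \<longrightarrow>
    (AE b in lborel. 0 < b \<and> b < 1 \<longrightarrow> P ((\<sigma>, b), ((1 - 2 * \<sigma>) * cos \<alpha>, sin \<alpha>)))"
proof (cases "\<sigma> = 0")
  case True
  from AE_bdry_circle[OF assms(1)] show ?thesis
  proof eventually_elim
    case (elim \<alpha>)
    show ?case
    proof
      assume "0 < \<alpha> \<and> \<alpha> < pi / 2"
      then have "AE s in lborel. s \<in> {0..<4} \<longrightarrow> P (perimeter s, (cos \<alpha>, sin \<alpha>))" using elim by auto
      \<comment> \<open>The left side is traversed downwards, with \<open>s = 4 - b\<close>.\<close>
      from AE_lborel_isometry[OF _ this, of "- 1" 4]
      have "AE b in lborel. 4 + - 1 * b \<in> {0..<4} \<longrightarrow> P (perimeter (4 + - 1 * b), (cos \<alpha>, sin \<alpha>))" by simp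
      then show "AE b in lborel. 0 < b \<and> b < 1 \<longrightarrow> P ((\<sigma>, b), ((1 - 2 * \<sigma>) * cos \<alpha>, sin \<alpha>))"
        by eventually_elim (auto simp: perimeter_def True)
    qed
  qed
next
  case False
  then have \<sigma>: "\<sigma> = 1" using assms(2) by simp
  \<comment> \<open>From the right side the ray runs leftwards, so its polar angle is
    \<open>pi - \<alpha>\<close>; there \<open>s = 1 + b\<close>.\<close>
  from AE_lborel_isometry[OF _ AE_bdry_circle[OF assms(1)], of "- 1" pi]
  have "AE \<alpha> in lborel. pi + - 1 * \<alpha> \<in> {0..<2 * pi} \<longrightarrow>
    (AE s in lborel. s \<in> {0..<4} \<longrightarrow> P (perimeter s, (cos (pi + - 1 * \<alpha>), sin (pi + - 1 * \<alpha>))))" by simp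
  then show ?thesis
  proof eventually_elim
    case (elim \<alpha>)
    show ?case
    proof
      assume "0 < \<alpha> \<and> \<alpha> < pi / 2"
      then have "AE s in lborel. s \<in> {0..<4} \<longrightarrow> P (perimeter s, (- cos \<alpha>, sin \<alpha>))" using elim by auto
      from AE_lborel_isometry[OF _ this, of 1 1]
      have "AE b in lborel. 1 + 1 * b \<in> {0..<4} \<longrightarrow> P (perimeter (1 + 1 * b), (- cos \<alpha>, sin \<alpha>))" by simp
      then show "AE b in lborel. 0 < b \<and> b < 1 \<longrightarrow> P ((\<sigma>, b), ((1 - 2 * \<sigma>) * cos \<alpha>, sin \<alpha>))"
        by eventually_elim (auto simp: perimeter_def \<sigma>)
    qed
  qed
qed

section \<open>Borel representatives and integrals along rays\<close>

text \<open>The preimages of a set under \<open>f\<close> and \<open>h\<close> differ by a subset of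
  a null set, which is measurable in the completion.\<close>

lemma measurable_completion_cong_AE:
  assumes h: "h \<in> M \<rightarrow>\<^sub>M N" and f: "f \<in> space M \<rightarrow> space N" and ae: "AE x in M. f x = h x"
  shows "f \<in> completion M \<rightarrow>\<^sub>M N"
proof (rule measurableI)
  fix A assume A: "A \<in> sets N"
  have "Measurable.pred (completion M) (\<lambda>x. (f x \<in> A) \<noteq> (h x \<in> A))"
    by (rule sets_completion_AE, use ae in eventually_elim) auto
  moreover have "Measurable.pred (completion M) (\<lambda>x. h x \<in> A)"
    using measurable_completion[OF h] A by measurable
  \<comment> \<open>Exclusive or with the same predicate twice gives back
    \<open>f x \<in> A\<close>.\<close>
  ultimately have "Measurable.pred (completion M) (\<lambda>x. ((f x \<in> A) \<noteq> (h x \<in> A)) \<noteq> (h x \<in> A))" by measurable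
  then have "Measurable.pred (completion M) (\<lambda>x. f x \<in> A)"
    by (simp cong: measurable_cong) (smt (verit, best) measurable_cong)
  then show "f -` A \<inter> space (completion M) \<in> sets (completion M)"
    by (simp add: pred_def vimage_def Int_def conj_commute)
qed (use f in auto)

text \<open>A Borel \<open>F\<close> restricts measurably to every line, and by Fubini almost every
  line of a given slope meets the null set \<open>N\<close> in a null set. Integrability follows
  from \<open>norm (f x) \<le> 1 + (norm (f x))\<^sup>2\<close> on the square, which has finite
  measure.\<close>

lemma L2_supported_borel_representative:
  assumes f: "f \<in> L2_supported K"
  obtains F N where "integrable lborel F" "\<And>z. z \<notin> Omega \<Longrightarrow> F z = 0"
    "N \<in> null_sets lborel" "\<And>z. z \<notin> N \<Longrightarrow> zero_extend f z = F z"
proof -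
  have Om: "open Omega" unfolding Omega_def by (intro open_Times) auto
  have fm: "f \<in> borel_measurable (lebesgue_on Omega)" and f2: "integrable (lebesgue_on Omega) (\<lambda>x. (norm (f x))\<^sup>2)"
    using f unfolding L2_supported_def by auto
  have zm: "zero_extend f \<in> borel_measurable lebesgue"
    using fm Om unfolding zero_extend_def
    by (subst measurable_restrict_space_iff[symmetric]) auto
  obtain R where R: "R \<in> borel_measurable lborel" "AE z in lborel. Re (zero_extend f z) = R z"
    using completion_ex_borel_measurable_real[of "\<lambda>z. Re (zero_extend f z)" lborel] zm by auto
  obtain I where I: "I \<in> borel_measurable lborel" "AE z in lborel. Im (zero_extend f z) = I z"
    using completion_ex_borel_measurable_real[of "\<lambda>z. Im (zero_extend f z)" lborel] zm by auto
  note [measurable] = R(1) I(1)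
  \<comment> \<open>The indicator makes \<open>F\<close> vanish at every point outside the square,
    not merely at almost every one.\<close>
  define F where "F = (\<lambda>z. indicator Omega z *\<^sub>R (complex_of_real (R z) + \<i> * complex_of_real (I z)))"
  have [measurable]: "Omega \<in> sets borel" using Om by auto
  have Fm [measurable]: "F \<in> borel_measurable borel"
    unfolding F_def by measurable
  have ae: "AE z in lborel. zero_extend f z = F z"
    using R(2) I(2) by eventually_elim (auto simp: F_def zero_extend_def indicator_def complex_eq_iff)
  then obtain N where N: "N \<in> null_sets lborel" "{z \<in> space lborel. zero_extend f z \<noteq> F z} \<subseteq> N"
    unfolding eventually_ae_filter by blast
  have fin: "emeasure (lebesgue_on Omega) (space (lebesgue_on Omega)) \<noteq> \<infinity>"
  proof -
    have "emeasure lborel Omega \<le> emeasure lborel (cbox (0, 0) (1, 1) :: plane set)"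
    proof (rule emeasure_mono)
      show "cbox (0, 0) (1, 1) \<in> sets (lborel :: plane measure)"
        unfolding sets_lborel by (intro borel_closed closed_cbox)
    qed (auto simp: Omega_def cbox_Pair_eq)
    also have "\<dots> < \<infinity>" by (simp add: emeasure_lborel_cbox_eq)
    finally show ?thesis using Om by (simp add: emeasure_restrict_space space_restrict_space)
  qed
  interpret finite_measure "lebesgue_on Omega" by (rule finite_measureI[OF fin])
  have "integrable (lebesgue_on Omega) f"
  proof (rule Bochner_Integration.integrable_bound)
    show "integrable (lebesgue_on Omega) (\<lambda>x. 1 + (norm (f x))\<^sup>2)" using f2 by simp
    show "AE x in lebesgue_on Omega. norm (f x) \<le> norm (1 + (norm (f x))\<^sup>2)"
    proof (rule AE_I2)
      fix x have "0 \<le> (1 - norm (f x))\<^sup>2" by simp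
      then show "norm (f x) \<le> norm (1 + (norm (f x))\<^sup>2)"
        by (simp add: power2_diff) (smt (verit, best) norm_ge_zero zero_le_power2)
    qed
  qed (rule fm)
  then have "integrable lebesgue (\<lambda>z. indicator Omega z *\<^sub>R f z)"
    using Om by (subst (asm) integrable_restrict_space) auto
  also have "(\<lambda>z. indicator Omega z *\<^sub>R f z) = zero_extend f" by (auto simp: zero_extend_def)
  finally have "integrable lebesgue F"
    using ae by (subst (asm) integrable_cong_AE[of _ _ F]) (auto simp: zm AE_completion_iff intro: measurable_completion)
  then have "integrable lborel F" by (simp add: integrable_completion)
  then show ?thesis using that[of F N] N by (auto simp: F_def)
qed

text \<open>The substitution \<open>x = c * t\<close> replaces time by horizontal distance. The half
  line can be extended to the full line because behind the starting side \<open>F\<close> is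
  0.\<close>

lemma line_integral_from_side:
  fixes F :: "plane \<Rightarrow> complex"
  assumes F [measurable]: "F \<in> borel_measurable borel" and F0: "\<And>z. z \<notin> Omega \<Longrightarrow> F z = 0"
    and N: "N \<in> null_sets lborel" and fF: "\<And>z. z \<notin> N \<Longrightarrow> f z = F z"
    and \<sigma>: "\<sigma> \<in> {0, 1}" and c: "0 < c"
    and ae: "AE x in lborel. (\<sigma> + (1 - 2 * \<sigma>) * x, y + s / c * x) \<notin> N"
  shows "(LINT t:{0<..}|lebesgue. f ((\<sigma>, y) + t *\<^sub>R ((1 - 2 * \<sigma>) * c, s)))
    = (1 / c) *\<^sub>R (LINT x|lborel. F (\<sigma> + (1 - 2 * \<sigma>) * x, y + s / c * x))"
proof -
  have Nb [measurable]: "N \<in> sets (borel \<Otimes>\<^sub>M borel)" using N unfolding borel_prod by auto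
  define line where "line = (\<lambda>t. (\<sigma> + (1 - 2 * \<sigma>) * (c * t), y + s / c * (c * t)))"
  have line: "(\<sigma>, y) + t *\<^sub>R ((1 - 2 * \<sigma>) * c, s) = line t" for t
    using c by (simp add: line_def mult_ac)
  have [measurable]: "line \<in> borel \<rightarrow>\<^sub>M borel" unfolding line_def by (simp add: borel_prod[symmetric])
  have "AE t in lborel. line t \<notin> N"
    using AE_borel_affine[of c _ 0, OF _ _ ae] c unfolding line_def by simp
  then have ae': "AE t in lborel. indicator {0<..} t *\<^sub>R f (line t) = F (line t)"
  proof eventually_elim
    case (elim t)
    show ?case
    proof (cases "0 < t")
      case False
      then have "c * t \<le> 0" using c by (simp add: mult_le_0_iff)
      then have "line t \<notin> Omega" using \<sigma> by (auto simp: line_def Omega_def)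
      then show ?thesis using False F0 by simp
    qed (use elim fF in simp)
  qed
  have "(LINT t:{0<..}|lebesgue. f ((\<sigma>, y) + t *\<^sub>R ((1 - 2 * \<sigma>) * c, s))) = (LINT t|lebesgue. F (line t))"
    unfolding set_lebesgue_integral_def line
    using ae' by (intro integral_cong_AE measurable_completion_cong_AE[OF _ _ ae'] measurable_completion)
      (auto simp: AE_completion_iff)
  also have "\<dots> = (LINT t|lborel. F (line t))" by (intro integral_completion) simp
  also have "(LINT x|lborel. F (\<sigma> + (1 - 2 * \<sigma>) * x, y + s / c * x)) = c *\<^sub>R \<dots>"
    using c unfolding line_def
    by (subst lborel_integral_real_affine[of c _ 0]) auto
  finally show ?thesis using c by simp
qed

text \<open>This is the descent step. Openness of \<open>E\<close> and of the complement of its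
  closure gives all nearby rays of small slope the same reflection pattern as the horizontal ray at
  height \<open>q\<close>.\<close>

lemma AE_zero_below_top:
  fixes F :: "plane \<Rightarrow> complex" and \<sigma> q :: real
  assumes E: "openin (top_of_set bdry) E"
    and data: "AE z in bdry_measure \<Otimes>\<^sub>M circle_measure.
        z \<in> Gamma_minus_on E \<and> regular E z \<longrightarrow> broken_ray_transform E f z = 0"
    and F: "integrable lborel F" and F0: "\<And>z. z \<notin> Omega \<Longrightarrow> F z = 0"
    and N: "N \<in> null_sets lborel" and fF: "\<And>z. z \<notin> N \<Longrightarrow> zero_extend f z = F z"
    and top: "AE z in lborel. q < snd z \<longrightarrow> F z = 0"
    and \<sigma>: "\<sigma> \<in> {0, 1}" and q: "0 < q" "q < 1" "(\<sigma>, q) \<in> E"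
    and ret: "(1 - \<sigma>, q) \<in> E \<or> (1 - \<sigma>, q) \<notin> top_of_set bdry closure_of E"
  obtains c where "c < q" "AE z in lborel. c < snd z \<longrightarrow> F z = 0"
proof -
  define \<tau> where "\<tau> = 1 - 2 * \<sigma>"
  have \<tau>: "\<bar>\<tau>\<bar> = 1" "\<bar>- \<tau>\<bar> = 1" using \<sigma> by (auto simp: \<tau>_def)
  have Fm [measurable]: "F \<in> borel_measurable borel" using F by auto
  define direct where "direct \<longleftrightarrow> (1 - \<sigma>, q) \<in> E"
  \<comment> \<open>The set in which the ray must hit the opposite side: in \<open>E\<close> if it ends there, away from the
    closure of \<open>E\<close> if it is reflected and returns to the side it started from.\<close>
  define U where "U = (if direct then E else bdry - top_of_set bdry closure_of E)"
  have U: "openin (top_of_set bdry) U"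
    using E openin_diff[OF openin_topspace closedin_closure_of, of "top_of_set bdry" E]
    by (auto simp: U_def)
  have "(1 - \<sigma>, q) \<in> U" using ret q \<sigma> by (auto simp: U_def direct_def mem_bdry)
  then obtain \<delta>1 where \<delta>1: "0 < \<delta>1" "\<And>b. \<bar>b - q\<bar> < \<delta>1 \<Longrightarrow> (1 - \<sigma>, b) \<in> U \<and> 0 < b \<and> b < 1"
    using openin_bdry_side[OF U, of "1 - \<sigma>" q] \<sigma> q by (auto simp: insert_commute)
  obtain \<delta>2 where \<delta>2: "0 < \<delta>2" "\<And>b. \<bar>b - q\<bar> < \<delta>2 \<Longrightarrow> (\<sigma>, b) \<in> E \<and> 0 < b \<and> b < 1"
    using openin_bdry_side[OF E q(3) \<sigma> q(1,2)] by auto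
  define \<delta> where "\<delta> = min \<delta>1 \<delta>2"
  have \<delta>: "0 < \<delta>" "\<And>b. \<bar>b - q\<bar> < \<delta> \<Longrightarrow> (1 - \<sigma>, b) \<in> U \<and> (\<sigma>, b) \<in> E \<and> 0 < b \<and> b < 1"
    using \<delta>1 \<delta>2 by (auto simp: \<delta>_def)
  \<comment> \<open>For \<open>c0 < b \<le> q\<close> and \<open>0 < a < \<epsilon>\<close>, the
    heights \<open>b\<close>, \<open>b + a\<close> and \<open>b + 2 * a\<close> lie within \<delta>
    of \<open>q\<close>, and also \<open>c0 + 2 * a < q\<close>.\<close>
  define c0 \<epsilon> where "c0 = q - \<delta> / 2" and "\<epsilon> = \<delta> / 8"
  \<comment> \<open>The mirror image is parametrised over \<open>1 \<le> x \<le> 2\<close>.\<close>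
  define \<kappa> :: complex where "\<kappa> = (if direct then 0 else 1)"
  define g where "g = (\<lambda>(x, y). F (\<sigma> + \<tau> * x, y) + \<kappa> * F (\<sigma> + 2 * \<tau> + - \<tau> * x, y))"
  have g_skew: "g = (\<lambda>z. F (skew \<sigma> \<tau> 0 z) + \<kappa> * F (skew (\<sigma> + 2 * \<tau>) (- \<tau>) 0 z))"
    by (auto simp: g_def skew_def)
  have g: "integrable lborel g"
    unfolding g_skew by (intro Bochner_Integration.integrable_add integrable_mult_right integrable_skew \<tau> F)
  have supp: "z \<in> cbox (0, 0) (2, 1)" if "g z \<noteq> 0" for z
  proof -
    obtain x y where z: "z = (x, y)" by (cases z)
    have "(\<sigma> + \<tau> * x, y) \<in> Omega \<or> (\<sigma> + 2 * \<tau> + - \<tau> * x, y) \<in> Omega"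
      using that F0 unfolding z g_def by force
    then show ?thesis using \<sigma> by (auto simp: z Omega_def cbox_Pair_eq \<tau>_def)
  qed

  define good where "good \<alpha> \<longleftrightarrow> (AE b in lborel. 0 < b \<and> b < 1 \<longrightarrow>
    (let z = ((\<sigma>, b), ((1 - 2 * \<sigma>) * cos \<alpha>, sin \<alpha>)) in
      z \<in> Gamma_minus_on E \<and> regular E z \<longrightarrow> broken_ray_transform E f z = 0))" for \<alpha>
  have good: "AE \<alpha> in lborel. 0 < \<alpha> \<and> \<alpha> < pi / 2 \<longrightarrow> good \<alpha>"
    using AE_bdry_circle_side[OF data \<sigma>] unfolding good_def Let_def .
  \<comment> \<open>\<open>S\<close> holds the small slopes of angles for which almost every
    starting height gives usable data.\<close>
  define S where "S = {tan \<alpha> | \<alpha>. 0 < \<alpha> \<and> \<alpha> < pi / 2 \<and> tan \<alpha> < \<epsilon> \<and> good \<alpha>}"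
  have S: "S \<subseteq> {0<..<\<epsilon>}"
  proof
    fix a assume "a \<in> S"
    then obtain \<alpha> where "0 < \<alpha>" "\<alpha> < pi / 2" "tan \<alpha> < \<epsilon>" "a = tan \<alpha>" by (auto simp: S_def)
    then show "a \<in> {0<..<\<epsilon>}" using tan_gt_zero[of \<alpha>] by simp
  qed
  have dense: "\<exists>a\<in>S. l < a \<and> a < r" if "0 \<le> l" "l < r" "r \<le> \<epsilon>" for l r
  proof -
    obtain \<alpha> where \<alpha>: "arctan l < \<alpha>" "\<alpha> < arctan r" "0 < \<alpha> \<and> \<alpha> < pi / 2 \<longrightarrow> good \<alpha>"
      using AE_lborel_dense[OF good arctan_monotone[OF \<open>l < r\<close>]] by blast
    have "0 \<le> arctan l" "arctan r < pi / 2" using that arctan_ubound[of r] by simp_all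
    then have \<alpha>': "0 < \<alpha>" "\<alpha> < pi / 2" using \<alpha>(1,2) by linarith+
    have "tan (arctan l) < tan \<alpha>" "tan \<alpha> < tan (arctan r)"
      using \<alpha>(1,2) \<alpha>' \<open>0 \<le> arctan l\<close> \<open>arctan r < pi / 2\<close> by (intro tan_monotone; linarith)+
    then have "l < tan \<alpha>" "tan \<alpha> < r" by (simp_all add: tan_arctan)
    moreover have "tan \<alpha> \<in> S"
      unfolding S_def using \<alpha>(3) \<alpha>' \<open>tan \<alpha> < r\<close> \<open>r \<le> \<epsilon>\<close> by (intro CollectI exI[of _ \<alpha>]) simp
    ultimately show ?thesis by blast
  qed

  have lines: "AE b in lborel. c0 < b \<longrightarrow> (LINT x|lborel. g (x, b + a * x)) = 0" if "a \<in> S" for a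
  proof -
    obtain \<alpha> where \<alpha>: "0 < \<alpha>" "\<alpha> < pi / 2" "good \<alpha>" and a: "a = tan \<alpha>" and a\<epsilon>: "a < \<epsilon>"
      using \<open>a \<in> S\<close> unfolding S_def by blast
    define c s where "c = cos \<alpha>" and "s = sin \<alpha>"
    have c: "0 < c" using \<alpha> by (simp add: c_def cos_gt_zero)
    have cs: "c\<^sup>2 + s\<^sup>2 = 1" by (simp add: c_def s_def)
    have a': "s / c = a" by (simp add: a tan_def c_def s_def)
    have a0: "0 < a" using \<alpha> by (simp add: a tan_gt_zero)
    have aeN: "AE z in lborel. z \<notin> N" using N by (rule AE_not_in)
    have aeN': "AE b in lborel. AE x in lborel. (p + \<rho> * x, b + a * x) \<notin> N" if "\<bar>\<rho>\<bar> = 1" for p \<rho>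
      using AE_lborel_snd_fst[OF AE_skew[OF that aeN, of p a]] by (simp add: skew_def)
    note int = integral_skew_iterated(1)[OF \<tau>(1) F, of \<sigma> a] integral_skew_iterated(1)[OF \<tau>(2) F, of "\<sigma> + 2 * \<tau>" a]
    have above: "AE b in lborel. AE x in lborel. q < b + a * x \<longrightarrow> g (x, b + a * x) = 0"
    proof -
      have "AE z in lborel. q < snd z \<longrightarrow> g z = 0"
        using AE_skew[OF \<tau>(1) top, of \<sigma> 0] AE_skew[OF \<tau>(2) top, of "\<sigma> + 2 * \<tau>" 0]
        by eventually_elim (auto simp: skew_def g_def)
      from AE_lborel_snd_fst[OF AE_skew[of 1, OF _ this, of 0 a]] show ?thesis by (simp add: skew_def)
    qed
    from above int aeN'[OF \<tau>(1), of \<sigma>] aeN'[OF \<tau>(2), of "\<sigma> + 2 * \<tau>"] \<alpha>(3)[unfolded good_def]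
    show ?thesis
    proof eventually_elim
      case (elim b)
      show ?case
      proof
        assume "c0 < b"
        show "(LINT x|lborel. g (x, b + a * x)) = 0"
        \<comment> \<open>A line starting above \<open>q\<close> stays above it for
          \<open>x \<ge> 0\<close> because \<open>a > 0\<close>, and \<open>g\<close> is 0 for
          \<open>x < 0\<close>. Otherwise the data of an actual ray are used.\<close>
        proof (cases "q < b")
          case True
          show ?thesis
          proof (rule integral_eq_zero_AE)
            from elim(1) show "AE x in lborel. g (x, b + a * x) = 0"
            proof eventually_elim
              case (elim x)
              show ?case
              proof (cases "0 \<le> x")
                case True
                then have "0 \<le> a * x" using a0 by simp
                then show ?thesis using elim \<open>q < b\<close> by (intro mp[OF elim]) linarith
              next
                case False then show ?thesis using supp[of "(x, b + a * x)"] by (auto simp: cbox_Pair_eq)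
              qed
            qed
          qed
        next
          case False
          have near: "\<bar>b - q\<bar> < \<delta>" "\<bar>b + a - q\<bar> < \<delta>" "\<bar>b + 2 * a - q\<bar> < \<delta>"
            using False \<open>c0 < b\<close> a0 a\<epsilon> unfolding c0_def \<epsilon>_def by auto
          note b0 = \<delta>(2)[OF near(1)] and b1 = \<delta>(2)[OF near(2)] and b2 = \<delta>(2)[OF near(3)]
          define z where "z = ((\<sigma>, b), ((1 - 2 * \<sigma>) * c, s))"
          define J0 J1 where "J0 = (LINT x|lborel. F (\<sigma> + \<tau> * x, b + a * x))"
            and "J1 = (LINT x|lborel. F (\<sigma> + 2 * \<tau> + - \<tau> * x, b + a * x))"
          have split: "(LINT x|lborel. g (x, b + a * x)) = J0 + \<kappa> * J1"
            unfolding g_def J0_def J1_def using elim(2,3) by simp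
          have trans: "regular E z \<Longrightarrow> broken_ray_transform E f z = 0"
            using elim(6) b0 unfolding z_def c_def s_def Let_def regular_def by auto
          have first: "(LINT t:{0<..}|lebesgue. zero_extend f (vertex z 0 + t *\<^sub>R direction z 0)) = (1 / c) *\<^sub>R J0"
            using line_integral_from_side[OF Fm F0 N fF \<sigma> c, of b s] elim(4)
            unfolding a' J0_def z_def \<tau>_def by simp
          show ?thesis
          proof (cases direct)
            case True
            then have "(1 - \<sigma>, b + s / c) \<in> E" using b1 by (simp add: U_def a')
            then have reg: "regular E z" and n: "num_refl E z = 0"
              using regular_no_reflection[OF E \<sigma> c cs, of b] b0 b1 unfolding z_def a' by auto
            have "(1 / c) *\<^sub>R J0 = 0"
              using trans[OF reg] first unfolding broken_ray_transform_def n by simp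
            then show ?thesis using c True by (simp add: split \<kappa>_def)
          next
            case False
            then have "(1 - \<sigma>, b + s / c) \<notin> top_of_set bdry closure_of E" using b1 by (simp add: U_def a')
            then have reg: "regular E z" and n: "num_refl E z = Suc 0"
              using regular_one_reflection[OF E \<sigma> c cs, of b] b0 b1 b2 unfolding z_def a' by auto
            have v1: "vertex z (Suc 0) = (1 - \<sigma>, b + a)" "direction z (Suc 0) = ((1 - 2 * (1 - \<sigma>)) * c, s)"
              using vertex_1_cross[OF \<sigma> c, of b s] direction_1_cross[OF \<sigma> c, of b s] b0 b1
              unfolding z_def a' by (auto simp: algebra_simps)
            \<comment> \<open>Moving the parameter by 1 turns the mirrored copy into the segment
              issued from the opposite side at height \<open>b + a\<close>.\<close>
            have shift: "\<sigma> + 2 * \<tau> + - \<tau> * (1 + 1 * x) = 1 - \<sigma> + (1 - 2 * (1 - \<sigma>)) * x"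
              "b + a * (1 + 1 * x) = b + a + a * x" for x by (simp_all add: \<tau>_def algebra_simps)
            have "AE x in lborel. (\<sigma> + 2 * \<tau> + - \<tau> * (1 + 1 * x), b + a * (1 + 1 * x)) \<notin> N"
              using AE_lborel_isometry[OF _ elim(5), of 1 1] by simp
            then have ae: "AE x in lborel. (1 - \<sigma> + (1 - 2 * (1 - \<sigma>)) * x, b + a + a * x) \<notin> N"
              unfolding shift .
            have "1 - \<sigma> \<in> {0, 1}" using \<sigma> by auto
            from line_integral_from_side[OF Fm F0 N fF this c, of "b + a" s]
            have "(LINT t:{0<..}|lebesgue. zero_extend f (vertex z (Suc 0) + t *\<^sub>R direction z (Suc 0)))
                = (1 / c) *\<^sub>R (LINT x|lborel. F (1 - \<sigma> + (1 - 2 * (1 - \<sigma>)) * x, b + a + a * x))"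
              unfolding a' v1 using ae by simp
            also have "(LINT x|lborel. F (1 - \<sigma> + (1 - 2 * (1 - \<sigma>)) * x, b + a + a * x)) = J1"
              unfolding J1_def by (subst lborel_integral_real_affine[of 1 _ 1]) (simp_all only: shift, simp_all)
            finally have "(1 / c) *\<^sub>R J0 + (1 / c) *\<^sub>R J1 = 0"
              using trans[OF reg] first unfolding broken_ray_transform_def n by (simp add: atMost_Suc add.commute)
            then have "(1 / c) *\<^sub>R (J0 + J1) = 0" by (simp add: scaleR_add_right)
            then show ?thesis using c False by (simp add: split \<kappa>_def)
          qed
        qed
      qed
    qed
  qed

  obtain a where a: "a \<in> S" using dense[of 0 \<epsilon>] \<delta>(1) by (auto simp: \<epsilon>_def)
  then have a\<epsilon>: "0 < a" "a < \<epsilon>" using S by auto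
  have "AE z in lborel. c0 < snd z - a * fst z \<longrightarrow> g z = 0"
    by (rule AE_zero_above_if_line_integrals_zero[OF g supp S dense lines a])
  \<comment> \<open>On the support of \<open>g\<close> the abscissa is at most 2, so the tilted line
    rises by at most \<open>2 * a\<close>.\<close>
  then have "AE z in lborel. c0 + 2 * a < snd z \<longrightarrow> g z = 0"
  proof eventually_elim
    case (elim z)
    show ?case
    proof (intro impI, rule ccontr)
      assume z: "c0 + 2 * a < snd z" "g z \<noteq> 0"
      then have "fst z \<le> 2" using supp[of z] by (cases z) (auto simp: cbox_Pair_eq)
      then have "a * fst z \<le> a * 2" using a\<epsilon> by (intro mult_left_mono) auto
      then show False using z elim by auto
    qed
  qed
  \<comment> \<open>This map inverts the parametrisation of the direct copy in \<open>g\<close>. At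
    a point of the square the mirrored term is evaluated outside the square and drops out.\<close>
  from AE_skew[OF \<tau>(1) this, of "- \<tau> * \<sigma>" 0]
  have "AE z in lborel. c0 + 2 * a < snd z \<longrightarrow> F z = 0"
  proof eventually_elim
    case (elim z)
    obtain x y where z: "z = (x, y)" by (cases z)
    show ?case
    proof (cases "z \<in> Omega")
      case True
      have "g (skew (- \<tau> * \<sigma>) \<tau> 0 z) = F z + \<kappa> * F (2 - 2 * \<sigma> - x, y)"
        using \<sigma> by (auto simp: z skew_def g_def \<tau>_def)
      moreover have "(2 - 2 * \<sigma> - x, y) \<notin> Omega" using True \<sigma> by (auto simp: z Omega_def)
      ultimately show ?thesis using elim F0 by (simp add: z skew_def)
    qed (simp add: F0)
  qed
  moreover have "c0 + 2 * a < q" using a\<epsilon> \<delta>(1) by (simp add: c0_def \<epsilon>_def)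
  ultimately show ?thesis using that by blast
qed

section \<open>Contradiction at the top of the essential support\<close>

theorem theorem1:
  fixes E K :: "plane set" and Nmax :: nat
  assumes "openin (top_of_set bdry) E"
    and "compactly_contained K (visible E Nmax)"
  shows "transform_injective_on E K"
  unfolding transform_injective_on_def
proof (intro ballI impI)
  fix f assume f: "f \<in> L2_supported K"
    and data: "AE z in bdry_measure \<Otimes>\<^sub>M circle_measure.
        z \<in> Gamma_minus_on E \<and> regular E z \<longrightarrow> broken_ray_transform E f z = 0"
  obtain F N where F: "integrable lborel F" and F0: "\<And>z. z \<notin> Omega \<Longrightarrow> F z = 0"
    and N: "N \<in> null_sets lborel" and fF: "\<And>z. z \<notin> N \<Longrightarrow> zero_extend f z = F z"
    using L2_supported_borel_representative[OF f] by blast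
  have Om: "Omega \<in> sets lebesgue" unfolding Omega_def
    by (rule sets_completionI_sets) (auto intro!: borel_open open_Times)
  have aeN: "AE z in lborel. z \<notin> N" using N by (rule AE_not_in)
  have "AE z in lebesgue. z \<in> Omega \<longrightarrow> z \<notin> K \<longrightarrow> f z = 0"
    using f Om unfolding L2_supported_def by (simp add: AE_restrict_space_iff)
  then have FK: "AE z in lborel. z \<notin> K \<longrightarrow> F z = 0"
    unfolding AE_completion_iff using aeN
    by eventually_elim (metis F0 fF zero_extend_def)
  define C where "C = {c. AE z in lborel. c < snd z \<longrightarrow> F z = 0}"
  have "AE z in lborel. F z = 0"
  proof (rule ccontr)
    assume no: "\<not> (AE z in lborel. F z = 0)"
    \<comment> \<open>A height \<open>c \<le> 0\<close> in \<open>C\<close> would give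
      \<open>F = 0\<close> almost everywhere; hence \<open>C\<close> is bounded below and its
      infimum is meaningful.\<close>
    have pos: "0 < c" if "c \<in> C" for c
    proof (rule ccontr)
      assume c: "\<not> 0 < c"
      have "AE z in lborel. c < snd z \<longrightarrow> F z = 0" using that by (simp add: C_def)
      then have "AE z in lborel. F z = 0"
      proof eventually_elim
        case (elim z)
        then show ?case using F0[of z] c by (cases "z \<in> Omega") (auto simp: Omega_def)
      qed
      with no show False by contradiction
    qed
    have "1 \<in> C" unfolding C_def using F0 by (auto simp: Omega_def)
    then have C: "C \<noteq> {}" "bdd_below C" using pos by (auto intro!: bdd_belowI less_imp_le)
    define q where "q = Inf C"
    have low: "\<not> c < q" if "c \<in> C" for c using cInf_lower[OF that C(2)] by (simp add: q_def)
    \<comment> \<open>Approaching \<open>q\<close> along a sequence keeps the union of exceptional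
      sets null, so the infimum itself belongs to \<open>C\<close>.\<close>
    have "AE z in lborel. \<forall>n::nat. q + 1 / Suc n < snd z \<longrightarrow> F z = 0"
      unfolding AE_all_countable
    proof
      fix n :: nat
      obtain c where "c \<in> C" "c < q + 1 / Suc n"
        using cInf_lessD[OF C(1), of "q + 1 / Suc n"] by (auto simp: q_def)
      then have "AE z in lborel. c < snd z \<longrightarrow> F z = 0" by (simp add: C_def)
      then show "AE z in lborel. q + 1 / Suc n < snd z \<longrightarrow> F z = 0"
        by eventually_elim (use \<open>c < q + 1 / Suc n\<close> in auto)
    qed
    then have top: "AE z in lborel. q < snd z \<longrightarrow> F z = 0"
    proof eventually_elim
      case (elim z)
      show ?case
      proof
        assume "q < snd z"
        then obtain n where "1 / real (Suc n) < snd z - q" using nat_approx_posE[of "snd z - q"] by auto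
        then show "F z = 0" using elim by (auto simp: algebra_simps)
      qed
    qed
    have K: "compact (closure K)" "closure K \<subseteq> visible E Nmax"
      using assms(2) by (auto simp: compactly_contained_def)
    \<comment> \<open>The projection of \<open>closure K\<close> is compact. If it missed
      \<open>q\<close>, it would miss a whole interval around \<open>q\<close>, and \<open>C\<close>
      would contain a height below its infimum.\<close>
    have "q \<in> snd ` closure K"
    proof (rule ccontr)
      assume "q \<notin> snd ` closure K"
      then have "q \<in> - snd ` closure K" by simp
      moreover have "open (- snd ` closure K)"
        by (intro open_Compl compact_imp_closed compact_continuous_image K continuous_intros)
      ultimately obtain e where e: "0 < e" "ball q e \<subseteq> - snd ` closure K"
        by (meson openE)
      from FK top have "AE z in lborel. q - e / 2 < snd z \<longrightarrow> F z = 0"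
      proof eventually_elim
        case (elim z)
        show ?case
        proof
          assume z: "q - e / 2 < snd z"
          show "F z = 0"
          proof (cases "q < snd z")
            case False
            then have "snd z \<in> ball q e" using z e(1) by (auto simp: dist_real_def)
            then have "z \<notin> K" using e(2) closure_subset[of K] by blast
            then show ?thesis using elim by simp
          qed (use elim in simp)
        qed
      qed
      then have "q - e / 2 \<in> C" by (simp add: C_def)
      then show False using low e(1) by force
    qed
    then obtain p where "(p, q) \<in> visible E Nmax" using K(2) by (auto simp: image_iff)
    then obtain \<sigma> where \<sigma>: "\<sigma> \<in> {0, 1}" "0 < q" "q < 1" "(\<sigma>, q) \<in> E"
      "(1 - \<sigma>, q) \<in> E \<or> (1 - \<sigma>, q) \<notin> top_of_set bdry closure_of E"
      using visible_horizontal[OF assms(1)] by metis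
    obtain c where "c < q" "AE z in lborel. c < snd z \<longrightarrow> F z = 0"
      using AE_zero_below_top[OF assms(1) data F F0 N fF top \<sigma>] by metis
    then show False using low by (auto simp: C_def)
  qed
  then have "AE z in lborel. z \<in> Omega \<longrightarrow> f z = 0"
    using aeN by eventually_elim (metis fF zero_extend_def)
  then show "AE x in lebesgue_on Omega. f x = 0"
    using Om by (simp add: AE_restrict_space_iff AE_completion_iff)
qed

end
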